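(* Let $N\ge 2$, let $\lambda>\lambda_*:=-\big(\frac{N-2}{2}\big)^2$, and let $S_\lambda$ be the Friedrichs extension of $-\Delta+\frac{\lambda}{|x|^2}$ in $L^2(\mathbb{R}^N)$. Then for every $g\in C_0^\infty(\mathbb{R}^N\setminus\{0\})$ the solution $W_{S_\lambda}(\cdot)g$ is uniformly bounded in $L^2(\mathbb{R}^N)$, that is, $\sup_{t\ge0}\|W_{S_\lambda}(t)g\|_{L^2(\mathbb{R}^N)}<\infty$.
   Context: $S_\lambda$ is the Friedrichs extension of the minimal realization $\big(-\Delta+\frac{\lambda}{|x|^2}\big)\big|_{C_0^\infty(\mathbb{R}^N\setminus\{0\})}$ (that is, $\Omega=\mathbb{R}^N\setminus\{0\}$, and $L^2(\Omega)$ is identified with $L^2(\mathbb{R}^N)$), which is nonnegative for $\lambda\ge\lambda_*$ by the Hardy inequality. $W_{S_\lambda}(\cdot)g$ denotes the solution $w$ of $\partial_t^2w-\Delta w+\frac{\lambda}{|x|^2}w=0$ in $(\mathbb{R}^N\setminus\{0\})\times(0,\infty)$ with $(w,\partial_tw)(\cdot,0)=(0,g)$, understood as the unique solution in $L^2(\mathbb{R}^N)$ of $w''(t)+S_\lambda w(t)=0$, $w(0)=0$, $w'(0)=g$; equivalently, $W_{S_\lambda}(t)g=\phi_t(S_\lambda)g$ by functional calculus with $\phi_t(\mu)=\sin(t\sqrt\mu)/\sqrt\mu$ for $\mu>0$ and $\phi_t(0)=t$. *)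

theory Defs
  imports "HOL-Analysis.Analysis"
begin

section \<open>The complex Hilbert space of square-integrable functions\<close>

definition square_integrable :: "('a::euclidean_space \<Rightarrow> complex) \<Rightarrow> bool" where
  "square_integrable f \<longleftrightarrow>
     f \<in> borel_measurable lborel \<and> integrable lborel (\<lambda>x. (cmod (f x))\<^sup>2)"

definition l2_rel :: "('a::euclidean_space \<Rightarrow> complex) \<Rightarrow> ('a \<Rightarrow> complex) \<Rightarrow> bool" where
  "l2_rel f g \<longleftrightarrow> square_integrable f \<and> square_integrable g \<and> (AE x in lborel. f x = g x)"

lemma square_integrable_0: "square_integrable (\<lambda>x. 0)"
  by (simp add: square_integrable_def)

lemma part_equivp_l2_rel: "part_equivp l2_rel"
proof (rule part_equivpI)
  show "\<exists>f. l2_rel f f"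
    using square_integrable_0 unfolding l2_rel_def by auto
  show "symp l2_rel"
    by (rule sympI) (auto simp: l2_rel_def elim: eventually_mono)
  show "transp l2_rel"
    by (rule transpI) (auto simp: l2_rel_def elim: eventually_elim2)
qed

quotient_type (overloaded) 'a l2 = "'a::euclidean_space \<Rightarrow> complex" / partial: l2_rel
  by (rule part_equivp_l2_rel)

lemma square_integrable_mult:
  assumes "square_integrable f" "square_integrable g"
  shows "integrable lborel (\<lambda>x. f x * cnj (g x))"
proof (rule Bochner_Integration.integrable_bound)
  show "integrable lborel (\<lambda>x. (cmod (f x))\<^sup>2 + (cmod (g x))\<^sup>2)"
    using assms by (simp add: square_integrable_def)
  have [measurable]: "f \<in> borel_measurable lborel" "g \<in> borel_measurable lborel"
    using assms by (auto simp: square_integrable_def)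
  have "(\<lambda>x. cnj (g x)) \<in> borel_measurable lborel"
    by (rule borel_measurable_continuous_on[where f = cnj]) (auto intro: continuous_intros)
  then show "(\<lambda>x. f x * cnj (g x)) \<in> borel_measurable lborel"
    by measurable
  show "AE x in lborel. norm (f x * cnj (g x)) \<le> norm ((cmod (f x))\<^sup>2 + (cmod (g x))\<^sup>2)"
  proof (rule AE_I2)
    fix x
    have "0 \<le> cmod (f x) * cmod (g x)"
      by simp
    then have "cmod (f x) * cmod (g x) \<le> (cmod (f x))\<^sup>2 + (cmod (g x))\<^sup>2"
      using sum_squares_bound[of "cmod (f x)" "cmod (g x)"] by linarith
    then show "norm (f x * cnj (g x)) \<le> norm ((cmod (f x))\<^sup>2 + (cmod (g x))\<^sup>2)"
      by (simp add: norm_mult)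
  qed
qed

lemma square_integrable_add:
  assumes "square_integrable f" "square_integrable g"
  shows "square_integrable (\<lambda>x. f x + g x)"
  unfolding square_integrable_def
proof
  have [measurable]: "f \<in> borel_measurable lborel" "g \<in> borel_measurable lborel"
    using assms by (auto simp: square_integrable_def)
  show m: "(\<lambda>x. f x + g x) \<in> borel_measurable lborel"
    by measurable
  show "integrable lborel (\<lambda>x. (cmod (f x + g x))\<^sup>2)"
  proof (rule Bochner_Integration.integrable_bound)
    show "integrable lborel (\<lambda>x. 2 * (cmod (f x))\<^sup>2 + 2 * (cmod (g x))\<^sup>2)"
      using assms by (simp add: square_integrable_def)
    show "(\<lambda>x. (cmod (f x + g x))\<^sup>2) \<in> borel_measurable lborel"
      using m by measurable
    show "AE x in lborel. norm ((cmod (f x + g x))\<^sup>2)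
            \<le> norm (2 * (cmod (f x))\<^sup>2 + 2 * (cmod (g x))\<^sup>2)"
    proof (rule AE_I2)
      fix x
      have "(cmod (f x + g x))\<^sup>2 \<le> (cmod (f x) + cmod (g x))\<^sup>2"
        by (intro power_mono norm_triangle_ineq) simp
      also have "\<dots> \<le> 2 * (cmod (f x))\<^sup>2 + 2 * (cmod (g x))\<^sup>2"
        using sum_squares_bound[of "cmod (f x)" "cmod (g x)"] by (simp add: power2_sum)
      finally show "norm ((cmod (f x + g x))\<^sup>2)
            \<le> norm (2 * (cmod (f x))\<^sup>2 + 2 * (cmod (g x))\<^sup>2)"
        by simp
    qed
  qed
qed

lemma square_integrable_scaleR:
  assumes "square_integrable f"
  shows "square_integrable (\<lambda>x. c *\<^sub>R f x)"
  using assms by (auto simp: square_integrable_def power_mult_distrib)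

lemma square_integrable_uminus:
  assumes "square_integrable f"
  shows "square_integrable (\<lambda>x. - f x)"
  using assms by (auto simp: square_integrable_def)

lemma square_integrable_diff:
  assumes "square_integrable f" "square_integrable g"
  shows "square_integrable (\<lambda>x. f x - g x)"
  using square_integrable_add[OF assms(1) square_integrable_uminus[OF assms(2)]] by simp

text \<open>The inner product of \<open>L\<^sup>2\<close>, linear in the first argument.\<close>

lift_definition l2_inner :: "('a::euclidean_space) l2 \<Rightarrow> 'a l2 \<Rightarrow> complex"
  is "\<lambda>f g. \<integral>x. f x * cnj (g x) \<partial>lborel"
proof -
  fix f f' g g' :: "'a \<Rightarrow> complex"
  assume ff: "l2_rel f f'" and gg: "l2_rel g g'"
  have i: "integrable lborel (\<lambda>x. f x * cnj (g x))" "integrable lborel (\<lambda>x. f' x * cnj (g' x))"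
    using ff gg by (auto simp: l2_rel_def intro: square_integrable_mult)
  have "AE x in lborel. f x * cnj (g x) = f' x * cnj (g' x)"
    using ff gg by (auto simp: l2_rel_def elim: eventually_elim2)
  then show "(\<integral>x. f x * cnj (g x) \<partial>lborel) = (\<integral>x. f' x * cnj (g' x) \<partial>lborel)"
    using i by (intro integral_cong_AE) auto
qed

instantiation l2 :: (euclidean_space) real_vector
begin

lift_definition zero_l2 :: "'a l2" is "\<lambda>x. 0"
  by (simp add: l2_rel_def square_integrable_0)

lift_definition plus_l2 :: "'a l2 \<Rightarrow> 'a l2 \<Rightarrow> 'a l2" is "\<lambda>f g x. f x + g x"
  by (auto simp: l2_rel_def square_integrable_add elim: eventually_elim2)

lift_definition minus_l2 :: "'a l2 \<Rightarrow> 'a l2 \<Rightarrow> 'a l2" is "\<lambda>f g x. f x - g x"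
  by (auto simp: l2_rel_def square_integrable_diff elim: eventually_elim2)

lift_definition uminus_l2 :: "'a l2 \<Rightarrow> 'a l2" is "\<lambda>f x. - f x"
  by (auto simp: l2_rel_def square_integrable_uminus elim: eventually_mono)

lift_definition scaleR_l2 :: "real \<Rightarrow> 'a l2 \<Rightarrow> 'a l2" is "\<lambda>c f x. c *\<^sub>R f x"
  by (auto simp: l2_rel_def intro!: square_integrable_scaleR elim: eventually_mono)

instance
proof
  fix u v w :: "'a l2" and a b :: real
  show "u + v + w = u + (v + w)"
    by transfer (auto simp: l2_rel_def add.assoc intro!: square_integrable_add)
  show "u + v = v + u"
    by transfer (auto simp: l2_rel_def add.commute intro!: square_integrable_add)
  show "0 + u = u"
    by transfer (auto simp: l2_rel_def)
  show "- u + u = 0"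
    by transfer (auto simp: l2_rel_def square_integrable_0)
  show "u - v = u + - v"
    by transfer (auto simp: l2_rel_def intro!: square_integrable_diff)
  show "a *\<^sub>R (u + v) = a *\<^sub>R u + a *\<^sub>R v"
    by transfer (auto simp: l2_rel_def scaleR_add_right
        intro!: square_integrable_add square_integrable_scaleR)
  show "(a + b) *\<^sub>R u = a *\<^sub>R u + b *\<^sub>R u"
    by transfer (auto simp: l2_rel_def scaleR_add_left
        intro!: square_integrable_add square_integrable_scaleR)
  show "a *\<^sub>R b *\<^sub>R u = (a * b) *\<^sub>R u"
    by transfer (auto simp: l2_rel_def intro!: square_integrable_scaleR)
  show "1 *\<^sub>R u = u"
    by transfer (auto simp: l2_rel_def)
qed

end

lemma l2_inner_add_left: "l2_inner (u + v) w = l2_inner u w + l2_inner v w"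
proof (transfer)
  fix f g h :: "'a \<Rightarrow> complex"
  assume "l2_rel f f" "l2_rel g g" "l2_rel h h"
  then have "integrable lborel (\<lambda>x. f x * cnj (h x))" "integrable lborel (\<lambda>x. g x * cnj (h x))"
    by (auto simp: l2_rel_def intro: square_integrable_mult)
  then show "(\<integral>x. (f x + g x) * cnj (h x) \<partial>lborel)
      = (\<integral>x. f x * cnj (h x) \<partial>lborel) + (\<integral>x. g x * cnj (h x) \<partial>lborel)"
    by (simp add: distrib_right)
qed

lemma l2_inner_scaleR_left: "l2_inner (c *\<^sub>R u) w = c *\<^sub>R l2_inner u w"
  by transfer simp

lemma l2_inner_commute: "l2_inner u v = cnj (l2_inner v u)"
proof transfer
  fix f g :: "'a \<Rightarrow> complex"
  have "cnj (\<integral>x. g x * cnj (f x) \<partial>lborel) = (\<integral>x. cnj (g x * cnj (f x)) \<partial>lborel)"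
    by (rule Bochner_Integration.integral_cnj[symmetric])
  then show "(\<integral>x. f x * cnj (g x) \<partial>lborel) = cnj (\<integral>x. g x * cnj (f x) \<partial>lborel)"
    by (simp add: mult.commute)
qed

lemma l2_inner_self: "l2_inner u u = of_real (Re (l2_inner u u))" "0 \<le> Re (l2_inner u u)"
  and l2_inner_eq_zero_iff: "Re (l2_inner u u) = 0 \<longleftrightarrow> u = 0"
proof -
  have *: "(\<integral>x. f x * cnj (f x) \<partial>lborel) = of_real (\<integral>x. (cmod (f x))\<^sup>2 \<partial>lborel)"
    for f :: "'a \<Rightarrow> complex"
  proof -
    have "(\<lambda>x. f x * cnj (f x)) = (\<lambda>x. complex_of_real ((cmod (f x))\<^sup>2))"
      by (rule ext) (rule complex_norm_square[symmetric])
    then show ?thesis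
      by (simp only: integral_complex_of_real)
  qed
  show "l2_inner u u = of_real (Re (l2_inner u u))" "0 \<le> Re (l2_inner u u)"
    by (transfer, simp add: *)+
  show "Re (l2_inner u u) = 0 \<longleftrightarrow> u = 0"
  proof transfer
    fix f :: "'a \<Rightarrow> complex"
    assume "l2_rel f f"
    then have "integrable lborel (\<lambda>x. (cmod (f x))\<^sup>2)" "square_integrable f"
      by (auto simp: l2_rel_def square_integrable_def)
    then show "Re (\<integral>x. f x * cnj (f x) \<partial>lborel) = 0 \<longleftrightarrow> l2_rel f (\<lambda>x. 0)"
      by (simp add: * integral_nonneg_eq_0_iff_AE l2_rel_def square_integrable_0)
  qed
qed

instantiation l2 :: (euclidean_space) real_inner
begin

definition inner_l2 :: "'a l2 \<Rightarrow> 'a l2 \<Rightarrow> real" where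
  "inner_l2 u v = Re (l2_inner u v)"

definition norm_l2 :: "'a l2 \<Rightarrow> real" where
  "norm_l2 u = sqrt (Re (l2_inner u u))"

definition dist_l2 :: "'a l2 \<Rightarrow> 'a l2 \<Rightarrow> real" where
  "dist_l2 u v = norm (u - v)"

definition sgn_l2 :: "'a l2 \<Rightarrow> 'a l2" where
  "sgn_l2 u = u /\<^sub>R norm u"

definition uniformity_l2 :: "('a l2 \<times> 'a l2) filter" where
  "uniformity_l2 = (INF e\<in>{0 <..}. principal {(u, v). dist u v < e})"

definition open_l2 :: "'a l2 set \<Rightarrow> bool" where
  "open_l2 U \<longleftrightarrow> (\<forall>u\<in>U. \<forall>\<^sub>F (u', v) in uniformity. u' = u \<longrightarrow> v \<in> U)"

instance
proof
  fix u v w :: "'a l2" and U :: "'a l2 set" and r :: real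
  show "dist u v = norm (u - v)"
    by (rule dist_l2_def)
  show "(uniformity :: ('a l2 \<times> 'a l2) filter) = (INF e\<in>{0 <..}. principal {(u, v). dist u v < e})"
    by (rule uniformity_l2_def)
  show "open U \<longleftrightarrow> (\<forall>u\<in>U. \<forall>\<^sub>F (u', v) in uniformity. u' = u \<longrightarrow> v \<in> U)"
    by (rule open_l2_def)
  show "sgn u = u /\<^sub>R norm u"
    by (rule sgn_l2_def)
  show "inner u v = inner v u"
    unfolding inner_l2_def by (subst l2_inner_commute) simp
  show "inner (u + v) w = inner u w + inner v w"
    by (simp add: inner_l2_def l2_inner_add_left)
  show "inner (r *\<^sub>R u) v = r * inner u v"
    by (simp add: inner_l2_def l2_inner_scaleR_left)
  show "0 \<le> inner u u"
    by (simp add: inner_l2_def l2_inner_self(2))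
  show "inner u u = 0 \<longleftrightarrow> u = 0"
    by (simp add: inner_l2_def l2_inner_eq_zero_iff)
  show "norm u = sqrt (inner u u)"
    by (simp add: norm_l2_def inner_l2_def)
qed

end

section \<open>Test functions\<close>

definition partial_deriv :: "'a::euclidean_space \<Rightarrow> ('a \<Rightarrow> complex) \<Rightarrow> 'a \<Rightarrow> complex" where
  "partial_deriv b f x = frechet_derivative f (at x) b"

primrec Ck :: "nat \<Rightarrow> ('a::euclidean_space \<Rightarrow> complex) \<Rightarrow> bool" where
  "Ck 0 f \<longleftrightarrow> continuous_on UNIV f"
| "Ck (Suc k) f \<longleftrightarrow> f differentiable_on UNIV \<and> (\<forall>b\<in>Basis. Ck k (partial_deriv b f))"

text \<open>An element of \<open>C\<^sub>0\<^sup>\<infinity>(\<Omega>)\<close> is represented by its extension by zero to the whole space.\<close>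

definition test_functions :: "'a::euclidean_space set \<Rightarrow> ('a \<Rightarrow> complex) set" where
  "test_functions \<Omega> =
     {\<phi>. (\<forall>k. Ck k \<phi>) \<and> compact (closure {x. \<phi> x \<noteq> 0}) \<and> closure {x. \<phi> x \<noteq> 0} \<subseteq> \<Omega>}"

definition laplacian :: "('a::euclidean_space \<Rightarrow> complex) \<Rightarrow> 'a \<Rightarrow> complex" where
  "laplacian f x = (\<Sum>b\<in>Basis. partial_deriv b (partial_deriv b f) x)"

section \<open>Friedrichs extension\<close>

text \<open>Unbounded operators are identified with their graphs in \<open>L\<^sup>2 \<times> L\<^sup>2\<close>.\<close>

definition adjoint_graph :: "(('a::euclidean_space) l2 \<times> 'a l2) set \<Rightarrow> ('a l2 \<times> 'a l2) set" where
  "adjoint_graph T = {(u, f). \<forall>(\<phi>, \<psi>)\<in>T. l2_inner u \<psi> = l2_inner f \<phi>}"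

text \<open>
  For a symmetric operator \<open>T\<close> bounded from below, the domain of the closure of the quadratic
  form \<open>\<phi> \<mapsto> \<langle>T \<phi>, \<phi>\<rangle>\<close>: the \<open>L\<^sup>2\<close>-limits of sequences in the domain
  of \<open>T\<close> that are Cauchy for the form.  The real part only serves to obtain a real number.
\<close>

definition form_domain :: "(('a::euclidean_space) l2 \<times> 'a l2) set \<Rightarrow> 'a l2 set" where
  "form_domain T = {u. \<exists>\<phi> \<psi>. (\<forall>n. (\<phi> n, \<psi> n) \<in> T) \<and> \<phi> \<longlonglongrightarrow> u \<and>
     (\<forall>e>0. \<exists>M::nat. \<forall>m\<ge>M. \<forall>n\<ge>M. Re (l2_inner (\<psi> m - \<psi> n) (\<phi> m - \<phi> n)) < e)}"

text \<open>The restriction of the adjoint of \<open>T\<close> to the form domain.\<close>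

definition friedrichs_extension ::
    "(('a::euclidean_space) l2 \<times> 'a l2) set \<Rightarrow> ('a l2 \<times> 'a l2) set" where
  "friedrichs_extension T = {(u, f) \<in> adjoint_graph T. u \<in> form_domain T}"

text \<open>
  Here \<open>abs_l2 f\<close> is the class of \<open>f\<close> modulo equality almost everywhere; it is applied
  only to continuous functions of compact support, which are square integrable.
  At the origin, where division by zero returns zero, \<open>\<phi>\<close> vanishes.
\<close>

definition inverse_square_minimal :: "real \<Rightarrow> (('a::euclidean_space) l2 \<times> 'a l2) set" where
  "inverse_square_minimal a =
     (\<lambda>\<phi>. (abs_l2 \<phi>, abs_l2 (\<lambda>x. - laplacian \<phi> x + of_real (a / (norm x)\<^sup>2) * \<phi> x)))
       ` test_functions (UNIV - {0})"

definition inverse_square_operator :: "real \<Rightarrow> (('a::euclidean_space) l2 \<times> 'a l2) set" where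
  "inverse_square_operator a = friedrichs_extension (inverse_square_minimal a)"

section \<open>The abstract wave equation\<close>

text \<open>
  \<open>w\<close> is a solution on \<open>[0, \<infinity>)\<close> of \<open>w'' + S w = 0\<close>, \<open>w 0 = 0\<close>, \<open>w' 0 = g\<close>: it is twice
  continuously differentiable into \<open>L\<^sup>2\<close>, with one-sided derivatives at \<open>0\<close>, and takes its
  values in the domain of \<open>S\<close>.
\<close>

definition wave_solution ::
    "(('a::euclidean_space) l2 \<times> 'a l2) set \<Rightarrow> 'a l2 \<Rightarrow> (real \<Rightarrow> 'a l2) \<Rightarrow> bool" where
  "wave_solution S g w \<longleftrightarrow> (\<exists>w' w''.
     (\<forall>t\<ge>0. (w has_vector_derivative w' t) (at t within {0..})) \<and>
     (\<forall>t\<ge>0. (w' has_vector_derivative w'' t) (at t within {0..})) \<and>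
     continuous_on {0..} w'' \<and>
     (\<forall>t\<ge>0. (w t, - w'' t) \<in> S) \<and>
     w 0 = 0 \<and> w' 0 = g)"

end

theory Submission
  imports Defs
begin

text \<open>
  Let \<open>S\<close> be the Friedrichs extension and \<open>\<delta> = a + ((N - 2) / 2)\<^sup>2 > 0\<close>.  Hardy's inequality gives
  \<open>\<delta> \<parallel>u / |x|\<parallel>\<^sup>2 \<le> \<langle>S u, u\<rangle>\<close>, and \<open>|x| g\<close> is square integrable, so that
  \<open>\<langle>g, u\<rangle>\<^sup>2 \<le> C \<langle>S u, u\<rangle>\<close> with \<open>C = \<parallel>|x| g\<parallel>\<^sup>2 / \<delta>\<close>.  In terms of the functional calculus, \<open>g = \<surd>S h\<close> for some \<open>h\<close>,
  and \<open>w t = sin (t \<surd>S) h\<close> is bounded; the following argument avoids the functional calculus.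
  Let \<open>G\<close> be the antiderivative of \<open>\<langle>g, w t\<rangle>\<close> with \<open>G 0 = 0\<close>.  By the symmetry of \<open>S\<close>, the function
  \<open>\<langle>w s, w t\<rangle>\<close> solves the one-dimensional wave equation, and following characteristics yields
  \<open>\<parallel>w t\<parallel>\<^sup>2 = G (2 t) / 2\<close>.  With \<open>W\<close> the integral of \<open>w\<close> from 0 to \<open>t\<close>, the inequality for \<open>u = W\<close> reads
  \<open>(G t)\<^sup>2 \<le> C (2 G t - G (2 t) / 2) \<le> 2 C G t\<close>, hence \<open>G \<le> 2 C\<close> and \<open>\<parallel>w t\<parallel>\<^sup>2 \<le> C\<close>.
  Riemann sums stand in for \<open>W\<close>, which avoids completeness of the space \<open>l2\<close>.
\<close>

section \<open>The abstract wave equation\<close>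

text \<open>The target space need not be complete, so an antiderivative is given in place of an
  integral. On each piece of length \<open>T / n\<close> the linearization bound, together with
  uniform continuity of \<open>f\<close>, leaves an error of at most \<open>e'\<close> times that
  length.\<close>

lemma riemann_sums_tendsto:
  fixes F f :: "real \<Rightarrow> 'b::real_normed_vector"
  assumes T: "0 \<le> T"
    and deriv: "\<And>x. x \<in> {0..T} \<Longrightarrow> (F has_vector_derivative f x) (at x within {0..T})"
    and cont: "continuous_on {0..T} f"
  shows "(\<lambda>n. (T / real n) *\<^sub>R (\<Sum>i<n. f (real i * T / real n))) \<longlonglongrightarrow> F T - F 0"
proof (rule LIMSEQ_I)
  fix e :: real assume "e > 0"
  \<comment> \<open>Adding 1 covers \<open>T = 0\<close> and makes the total error
    \<open>T * e'\<close> strictly smaller than \<open>e\<close>.\<close>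
  define e' where "e' = e / (T + 1)"
  have e': "e' > 0" using \<open>e > 0\<close> T by (simp add: e'_def)
  have "uniformly_continuous_on {0..T} f"
    using cont by (simp add: compact_uniformly_continuous)
  then obtain d where d: "d > 0"
    "\<And>x y. x \<in> {0..T} \<Longrightarrow> y \<in> {0..T} \<Longrightarrow> dist y x < d \<Longrightarrow> dist (f y) (f x) < e'"
    using e' unfolding uniformly_continuous_on_def by metis
  obtain n0 :: nat where n0: "T / d < real n0"
    using reals_Archimedean2 by blast
  have "norm ((T / real n) *\<^sub>R (\<Sum>i<n. f (real i * T / real n)) - (F T - F 0)) < e" if n: "n \<ge> n0" for n
  proof -
    have npos: "0 < real n" and small: "T / real n < d"
    proof -
      have "0 \<le> T / d" using T d by simp
      then show "0 < real n" using n0 n by linarith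
      moreover have "T / d < real n" using n0 n by linarith
      ultimately show "T / real n < d" using d by (simp add: field_simps)
    qed
    define x where "x i = real i * T / real n" for i
    have step: "x (Suc i) - x i = T / real n" for i
      by (simp add: x_def add_divide_distrib distrib_right)
    have piece: "norm (F (x (Suc i)) - F (x i) - (T / real n) *\<^sub>R f (x i)) \<le> T / real n * e'"
      if "i < n" for i
    proof -
      have "real (Suc i) * T \<le> real n * T"
        using that T by (intro mult_right_mono) auto
      then have le: "x (Suc i) \<le> T" using npos by (simp add: x_def field_simps)
      have ge: "0 \<le> x i" using T npos by (simp add: x_def)
      have inc: "x i \<le> x (Suc i)" using step[of i] T npos by (simp add: algebra_simps)
      have "norm (F (x (Suc i)) - F (x i) - (x (Suc i) - x i) *\<^sub>R f (x i)) \<le> norm (x (Suc i) - x i) * e'"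
      proof (rule vector_differentiable_bound_linearization)
        show "(F has_vector_derivative f y) (at y within {x i..x (Suc i)})" if "y \<in> {x i..x (Suc i)}" for y
          using deriv[of y] that le ge
          by (auto intro: has_vector_derivative_within_subset)
        show "closed_segment (x i) (x (Suc i)) \<subseteq> {x i..x (Suc i)}"
          using inc by (simp add: closed_segment_eq_real_ivl)
        show "norm (f y - f (x i)) \<le> e'" if "y \<in> {x i..x (Suc i)}" for y
        proof -
          have "dist y (x i) < d" using that small step[of i] by (auto simp: dist_real_def)
          then show ?thesis
            using d(2)[of "x i" y] that le ge inc by (auto simp: dist_norm)
        qed
        show "x i \<in> {x i..x (Suc i)}" using inc by simp
      qed
      then show ?thesis using T npos by (simp add: step)
    qed
    have ends: "x n = T" "x 0 = 0" using npos by (auto simp: x_def)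
    have "(F T - F 0) - (T / real n) *\<^sub>R (\<Sum>i<n. f (x i)) =
        (\<Sum>i<n. F (x (Suc i)) - F (x i) - (T / real n) *\<^sub>R f (x i))"
      using sum_lessThan_telescope[of "\<lambda>i. F (x i)" n] ends
      by (simp add: sum_subtractf scaleR_sum_right)
    also have "norm \<dots> \<le> (\<Sum>i<n. T / real n * e')"
      by (rule sum_norm_le) (use piece in auto)
    also have "\<dots> = T * e'" using npos by simp
    also have "\<dots> < e" using \<open>e > 0\<close> T by (simp add: e'_def field_simps)
    finally show ?thesis by (simp add: x_def norm_minus_commute)
  qed
  then show "\<exists>no. \<forall>n\<ge>no. norm ((T / real n) *\<^sub>R (\<Sum>i<n. f (real i * T / real n)) - (F T - F 0)) < e"
    by blast
qed

text \<open>One rule for motion along characteristics: \<open>c\<close> will be 1, -1 or 2. Later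
  equations keep terms such as \<open>0 + 1 * s\<close> unsimplified so that they match the shape
  \<open>p + c * r\<close>.\<close>

lemma has_vector_derivative_affine_within:
  fixes f f' :: "real \<Rightarrow> 'b::real_normed_vector"
  assumes "\<And>x. x \<ge> 0 \<Longrightarrow> (f has_vector_derivative f' x) (at x within {0..})"
    and "\<And>r. r \<in> {0..s} \<Longrightarrow> 0 \<le> p + c * r" "r \<in> {0..s}"
  shows "((\<lambda>r. f (p + c * r)) has_vector_derivative c *\<^sub>R f' (p + c * r)) (at r within {0..s})"
proof -
  have "((f \<circ> (\<lambda>r. p + c * r)) has_vector_derivative c *\<^sub>R f' (p + c * r)) (at r within {0..s})"
  proof (rule vector_diff_chain_within)
    show "((\<lambda>r. p + c * r) has_vector_derivative c) (at r within {0..s})"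
      by (auto intro!: derivative_eq_intros simp flip: has_real_derivative_iff_has_vector_derivative)
    show "(f has_vector_derivative f' (p + c * r)) (at (p + c * r) within (\<lambda>r. p + c * r) ` {0..s})"
      by (rule has_vector_derivative_within_subset[OF assms(1)]) (use assms(2,3) in auto)
  qed
  then show ?thesis by (simp add: o_def)
qed

lemma has_vector_derivative_zero_endpoints:
  fixes f :: "real \<Rightarrow> 'b::real_normed_vector"
  assumes "0 \<le> s" "\<And>r. r \<in> {0..s} \<Longrightarrow> (f has_vector_derivative 0) (at r within {0..s})"
  shows "f s = f 0"
proof -
  have "\<exists>c. \<forall>x\<in>{0..s}. f x = c"
    by (rule has_derivative_zero_constant) (use assms(2) in \<open>auto simp: has_vector_derivative_def\<close>)
  then show ?thesis using assms(1) by auto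
qed

lemmas has_vector_derivative_inner = bounded_bilinear.has_vector_derivative[OF bounded_bilinear_inner]

lemma antiderivative_halfline:
  fixes f :: "real \<Rightarrow> real"
  assumes "continuous_on {0..} f"
  obtains F where "F 0 = 0" "\<And>x. x \<ge> 0 \<Longrightarrow> (F has_vector_derivative f x) (at x within {0..})"
proof (rule that[of "\<lambda>x. integral {0..x} f"])
  show "integral {0..0} f = 0" by simp
  fix x :: real assume x: "x \<ge> 0"
  have "((\<lambda>u. integral {0..u} f) has_vector_derivative f x) (at x within {0..x + 1})"
    using x by (intro integral_has_vector_derivative continuous_on_subset[OF assms]) auto
  \<comment> \<open>The right end \<open>x + 1\<close> keeps \<open>x\<close> off the right
    boundary, also for \<open>x = 0\<close>, so both sets agree near \<open>x\<close>.\<close>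
  moreover have "at x within {0..x + 1} = at x within {0..}"
    by (rule at_within_nhd[where S = "{..<x + 1}"]) auto
  ultimately show "((\<lambda>u. integral {0..u} f) has_vector_derivative f x) (at x within {0..})"
    by simp
qed

section \<open>The method of characteristics for a symmetric operator\<close>

text \<open>\<open>S\<close> is a graph, and its linearity is what places the Riemann sums of
  \<open>w\<close> in its domain. Symmetry drives the characteristics; \<open>bound\<close> is then
  evaluated on these sums.\<close>

lemma symmetric_wave_bound:
  fixes S :: "('h::real_inner \<times> 'h) set"
  assumes S: "subspace S"
    and sym: "\<And>u f v h. (u, f) \<in> S \<Longrightarrow> (v, h) \<in> S \<Longrightarrow> inner f v = inner u h"
    and bound: "\<And>u f. (u, f) \<in> S \<Longrightarrow> (inner g u)\<^sup>2 \<le> C * inner f u"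
    and C: "C \<ge> 0"
    and w: "\<And>t. t \<ge> 0 \<Longrightarrow> (w has_vector_derivative w' t) (at t within {0..})"
    and w': "\<And>t. t \<ge> 0 \<Longrightarrow> (w' has_vector_derivative w'' t) (at t within {0..})"
    and w'': "continuous_on {0..} w''"
    and eq: "\<And>t. t \<ge> 0 \<Longrightarrow> (w t, - w'' t) \<in> S"
    and init: "w 0 = 0" "w' 0 = g"
    and t: "t \<ge> 0"
  shows "(norm (w t))\<^sup>2 \<le> C"
proof -
  have cont: "continuous_on {0..} w" "continuous_on {0..} w'"
    using w w' by (auto simp: continuous_on_eq_continuous_within intro: has_vector_derivative_continuous)
  \<comment> \<open>The two minus signs cancel. The identity says that
    \<open>inner (w r) (w s)\<close> has the same second derivative in \<open>r\<close> as in
    \<open>s\<close>.\<close>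
  have sym_w: "inner (w'' r) (w s) = inner (w r) (w'' s)" if "r \<ge> 0" "s \<ge> 0" for r s
    using sym[OF eq[OF that(1)] eq[OF that(2)]] by simp
  define \<gamma> where "\<gamma> t = inner g (w t)" for t
  have "continuous_on {0..} \<gamma>"
    unfolding \<gamma>_def by (intro continuous_intros cont)
  then obtain G where G0: "G 0 = 0"
    and G: "\<And>x. x \<ge> 0 \<Longrightarrow> (G has_vector_derivative \<gamma> x) (at x within {0..})"
    using antiderivative_halfline by blast
  note dw = has_vector_derivative_affine_within[where f = w and f' = w', OF w]
  note dw' = has_vector_derivative_affine_within[where f = w' and f' = w'', OF w']
  note dG = has_vector_derivative_affine_within[where f = G and f' = \<gamma>, OF G]
  \<comment> \<open>The sum of the two first-order derivatives of \<open>inner (w p) (w q)\<close>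
    is constant along \<open>p = t + r\<close>, \<open>q = s - r\<close>. At \<open>r = s\<close>
    the second time is 0, and the initial data leave \<open>\<gamma> (t + s)\<close>.\<close>
  have plus: "inner (w' t) (w s) + inner (w t) (w' s) = \<gamma> (t + s)" if "0 \<le> s" "s \<le> t" for s t
  proof -
    have "inner (w' (t + 1 * s)) (w (s + -1 * s)) + inner (w (t + 1 * s)) (w' (s + -1 * s)) =
      inner (w' (t + 1 * 0)) (w (s + -1 * 0)) + inner (w (t + 1 * 0)) (w' (s + -1 * 0))"
    proof (rule has_vector_derivative_zero_endpoints[OF that(1)])
      fix r assume r: "r \<in> {0..s}"
      show "((\<lambda>r. inner (w' (t + 1 * r)) (w (s + -1 * r)) + inner (w (t + 1 * r)) (w' (s + -1 * r)))
        has_vector_derivative 0) (at r within {0..s})"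
        by (rule has_vector_derivative_eq_rhs,
           rule has_vector_derivative_add[OF has_vector_derivative_inner[OF dw' dw] has_vector_derivative_inner[OF dw dw']])
         (use r that in \<open>auto simp: sym_w\<close>)
    qed
    then show ?thesis by (simp add: init \<gamma>_def inner_commute)
  qed
  \<comment> \<open>The difference of the two derivatives is constant along the other family of
    characteristics, traced back from the times \<open>(t, s)\<close> to
    \<open>(t - s, 0)\<close>.\<close>
  have minus: "inner (w' t) (w s) - inner (w t) (w' s) = - \<gamma> (t - s)" if "0 \<le> s" "s \<le> t" for s t
  proof -
    have "inner (w' ((t - s) + 1 * s)) (w (0 + 1 * s)) - inner (w ((t - s) + 1 * s)) (w' (0 + 1 * s)) =
      inner (w' ((t - s) + 1 * 0)) (w (0 + 1 * 0)) - inner (w ((t - s) + 1 * 0)) (w' (0 + 1 * 0))"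
    proof (rule has_vector_derivative_zero_endpoints[OF that(1)])
      fix r assume r: "r \<in> {0..s}"
      show "((\<lambda>r. inner (w' ((t - s) + 1 * r)) (w (0 + 1 * r)) - inner (w ((t - s) + 1 * r)) (w' (0 + 1 * r)))
        has_vector_derivative 0) (at r within {0..s})"
        by (rule has_vector_derivative_eq_rhs,
           rule has_vector_derivative_diff[OF has_vector_derivative_inner[OF dw' dw] has_vector_derivative_inner[OF dw dw']])
         (use r that in \<open>auto simp: sym_w\<close>)
    qed
    then show ?thesis by (simp add: init \<gamma>_def inner_commute)
  qed
  \<comment> \<open>\<open>plus\<close> at equal times identifies the derivative of the squared norm
    as \<open>\<gamma> (2 * t)\<close>, which is also that of \<open>G (2 * t) / 2\<close>.\<close>
  have norm_w: "(norm (w t))\<^sup>2 = G (2 * t) / 2" if "t \<ge> 0" for t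
  proof -
    have "inner (w (0 + 1 * t)) (w (0 + 1 * t)) - (1 / 2) * G (0 + 2 * t) =
      inner (w (0 + 1 * 0)) (w (0 + 1 * 0)) - (1 / 2) * G (0 + 2 * 0)"
    proof (rule has_vector_derivative_zero_endpoints[OF that])
      fix r assume r: "r \<in> {0..t}"
      show "((\<lambda>t. inner (w (0 + 1 * t)) (w (0 + 1 * t)) - (1 / 2) * G (0 + 2 * t))
        has_vector_derivative 0) (at r within {0..t})"
        by (rule has_vector_derivative_eq_rhs,
           rule has_vector_derivative_diff[OF has_vector_derivative_inner[OF dw dw] has_vector_derivative_mult_right[OF dG]])
         (use r plus[of r r] in \<open>auto\<close>)
    qed
    then show ?thesis by (simp add: init G0 power2_norm_eq_inner)
  qed
  have G_nonneg: "G t \<ge> 0" if "t \<ge> 0" for t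
  proof -
    have "G t = 2 * (norm (w (t / 2)))\<^sup>2" using norm_w[of "t / 2"] that by simp
    then show ?thesis by simp
  qed
  have G_bound: "(G t)\<^sup>2 \<le> C * (2 * G t - G (2 * t) / 2)" if t: "t \<ge> 0" for t
  proof -
    \<comment> \<open>\<open>U n\<close> stands for the integral of \<open>w\<close> and
      \<open>V n\<close> for \<open>S\<close> applied to it, that is, for minus the integral of
      \<open>w''\<close>, whose value is \<open>g - w' t\<close>.\<close>
    define U where "U n = (t / real n) *\<^sub>R (\<Sum>i<n. w (real i * t / real n))" for n :: nat
    define V where "V n = - ((t / real n) *\<^sub>R (\<Sum>i<n. w'' (real i * t / real n)))" for n :: nat
    have pt: "0 \<le> real i * t / real n" for i n using t by simp
    have "(U n, V n) \<in> S" for n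
    proof -
      have "(t / real n) *\<^sub>R (\<Sum>i<n. (w (real i * t / real n), - w'' (real i * t / real n))) \<in> S"
        by (intro subspace_scale[OF S] subspace_sum[OF S] eq pt)
      also have "(t / real n) *\<^sub>R (\<Sum>i<n. (w (real i * t / real n), - w'' (real i * t / real n))) = (U n, V n)"
        by (simp add: U_def V_def prod_eq_iff fst_sum snd_sum sum_negf)
      finally show ?thesis .
    qed
    then have ineq: "(inner g (U n))\<^sup>2 \<le> C * inner (V n) (U n)" for n
      using bound by blast
    have sub: "(h has_vector_derivative h' x) (at x within {0..t})"
      if "\<And>x. x \<ge> 0 \<Longrightarrow> (h has_vector_derivative h' x) (at x within {0..})" "x \<in> {0..t}"
      for h :: "real \<Rightarrow> 'c::real_normed_vector" and h' x
      by (rule has_vector_derivative_within_subset[OF that(1)]) (use that(2) in auto)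
    have csub: "continuous_on {0..t} h" if "continuous_on {0..} h" for h :: "real \<Rightarrow> 'c::real_normed_vector"
      using that by (auto intro: continuous_on_subset)
    have Vlim: "V \<longlonglongrightarrow> g - w' t"
      unfolding V_def
      using tendsto_minus[OF riemann_sums_tendsto[OF t sub[OF w'] csub[OF w'']]] by (simp add: init)
    have innerU: "inner v (U n) = (t / real n) *\<^sub>R (\<Sum>i<n. inner v (w (real i * t / real n)))" for v n
      by (simp add: U_def inner_sum_right)
    have gU: "(\<lambda>n. inner g (U n)) \<longlonglongrightarrow> G t"
      unfolding innerU
      using riemann_sums_tendsto[OF t sub[OF G] csub[OF \<open>continuous_on {0..} \<gamma>\<close>]] by (simp add: G0 \<gamma>_def)
    have vU: "(\<lambda>n. inner (g - w' t) (U n)) \<longlonglongrightarrow> 2 * G t - G (2 * t) / 2"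
    proof -
      \<comment> \<open>By \<open>plus\<close> and \<open>minus\<close>,
        \<open>inner (w' t) (w s)\<close> is half of
        \<open>\<gamma> (t + s) - \<gamma> (t - s)\<close>; hence \<open>H\<close> is an
        antiderivative in \<open>s\<close> of \<open>inner (g - w' t) (w s)\<close>.\<close>
      define H where "H s = G (0 + 1 * s) - (1 / 2) * (G (t + 1 * s) + G (t + -1 * s))" for s
      have H: "(H has_vector_derivative inner (g - w' t) (w s)) (at s within {0..t})" if s: "s \<in> {0..t}" for s
        unfolding H_def
        by (rule has_vector_derivative_eq_rhs,
           rule has_vector_derivative_diff[OF dG has_vector_derivative_mult_right[OF has_vector_derivative_add[OF dG dG]]])
         (use s t plus[of s t] minus[of s t] in \<open>auto simp: inner_diff_left \<gamma>_def field_simps\<close>)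
      have "continuous_on {0..t} (\<lambda>s. inner (g - w' t) (w s))"
        by (intro continuous_intros csub cont)
      from riemann_sums_tendsto[OF t H this]
      have "(\<lambda>n. inner (g - w' t) (U n)) \<longlonglongrightarrow> H t - H 0"
        unfolding innerU .
      moreover have "H t - H 0 = 2 * G t - G (2 * t) / 2"
        by (simp add: H_def G0 field_simps)
      ultimately show ?thesis by simp
    qed
    have "bounded (w ` {0..t})"
      by (intro compact_imp_bounded compact_continuous_image csub cont) simp
    then obtain B where B: "\<And>s. s \<in> {0..t} \<Longrightarrow> norm (w s) \<le> B"
      unfolding bounded_iff by blast
    have Ub: "norm (U n) \<le> t * B" for n
    proof (cases "n = 0")
      case True
      then show ?thesis using t B[of 0] by (simp add: U_def init)
    next
      case False
      have "norm (\<Sum>i<n. w (real i * t / real n)) \<le> (\<Sum>i<n. B)"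
      proof (rule sum_norm_le)
        fix i assume "i \<in> {..<n}"
        then have "real i * t \<le> real n * t" using t by (intro mult_right_mono) auto
        then show "norm (w (real i * t / real n)) \<le> B"
          using B[of "real i * t / real n"] pt[of i n] False by (simp add: field_simps)
      qed
      then have "t / real n * norm (\<Sum>i<n. w (real i * t / real n)) \<le> t / real n * (real n * B)"
        using t by (intro mult_left_mono) auto
      then show ?thesis using t False by (simp add: U_def)
    qed
    have "(\<lambda>n. inner (V n - (g - w' t)) (U n)) \<longlonglongrightarrow> 0"
    proof (rule Lim_null_comparison)
      show "\<forall>\<^sub>F n in sequentially. norm (inner (V n - (g - w' t)) (U n)) \<le> norm (V n - (g - w' t)) * (t * B)"
      proof (intro always_eventually allI)
        fix n
        have "\<bar>inner (V n - (g - w' t)) (U n)\<bar> \<le> norm (V n - (g - w' t)) * norm (U n)"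
          by (rule Cauchy_Schwarz_ineq2)
        also have "\<dots> \<le> norm (V n - (g - w' t)) * (t * B)"
          by (rule mult_left_mono[OF Ub norm_ge_zero])
        finally show "norm (inner (V n - (g - w' t)) (U n)) \<le> norm (V n - (g - w' t)) * (t * B)"
          by simp
      qed
      show "(\<lambda>n. norm (V n - (g - w' t)) * (t * B)) \<longlonglongrightarrow> 0"
        using tendsto_mult_left_zero[OF tendsto_norm_zero[OF LIM_zero[OF Vlim]]] .
    qed
    from tendsto_add[OF this vU] have VU: "(\<lambda>n. inner (V n) (U n)) \<longlonglongrightarrow> 2 * G t - G (2 * t) / 2"
      by (simp add: inner_diff_left)
    show ?thesis
      by (rule LIMSEQ_le[OF tendsto_power[OF gU] tendsto_mult_left[OF VU]]) (use ineq in auto)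
  qed
  \<comment> \<open>\<open>G_bound\<close> is taken at time \<open>2 * t\<close>, and the
    nonnegative term at time \<open>4 * t\<close> is dropped. Cancelling one factor
    \<open>G (2 * t)\<close> gives the bound; if that factor is 0, \<open>C \<ge> 0\<close>
    suffices.\<close>
  have "G (2 * t) * G (2 * t) \<le> C * (2 * G (2 * t) - G (2 * (2 * t)) / 2)"
    using G_bound[of "2 * t"] t by (simp add: power2_eq_square)
  also have "\<dots> \<le> C * (2 * G (2 * t))"
    using G_nonneg[of "2 * (2 * t)"] t C by (intro mult_left_mono) auto
  finally have "G (2 * t) * G (2 * t) \<le> (2 * C) * G (2 * t)"
    by (simp add: mult_ac)
  moreover have "0 \<le> G (2 * t)" using G_nonneg t by simp
  ultimately have "G (2 * t) \<le> 2 * C"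
    using C by (metis linorder_not_le mult_le_cancel_right not_less_iff_gr_or_eq order_antisym zero_le_mult_iff zero_le_numeral)
  then show ?thesis using norm_w[OF t] by simp
qed

section \<open>Friedrichs extensions\<close>

text \<open>The form is nonnegative at \<open>x + s *\<^sub>R y\<close> for every real
  \<open>s\<close>, so a polynomial of degree at most two in \<open>s\<close> takes no negative
  value. A degenerate form makes that polynomial affine, hence the case distinction.\<close>

lemma form_Cauchy_Schwarz:
  fixes T :: "('h::real_inner \<times> 'h) set"
  assumes T: "subspace T"
    and sym: "\<And>x f y h. (x, f) \<in> T \<Longrightarrow> (y, h) \<in> T \<Longrightarrow> inner f y = inner x h"
    and pos: "\<And>x f. (x, f) \<in> T \<Longrightarrow> 0 \<le> inner f x"
    and xf: "(x, f) \<in> T" and yh: "(y, h) \<in> T"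
  shows "(inner f y)\<^sup>2 \<le> inner f x * inner h y"
proof -
  have quad: "0 \<le> inner f x + 2 * s * inner f y + s * s * inner h y" for s :: real
  proof -
    have "(x, f) + s *\<^sub>R (y, h) \<in> T"
      by (intro subspace_add[OF T] subspace_scale[OF T] xf yh)
    then have "0 \<le> inner (f + s *\<^sub>R h) (x + s *\<^sub>R y)" using pos by simp
    moreover have "inner h x = inner f y" using sym[OF xf yh] by (simp add: inner_commute)
    ultimately show ?thesis
      by (simp add: inner_add_left inner_add_right algebra_simps)
  qed
  have hy: "0 \<le> inner h y" by (rule pos[OF yh])
  show ?thesis
  proof (cases "inner h y = 0")
    case True
    have "inner f y = 0"
    proof (rule ccontr)
      assume "inner f y \<noteq> 0"
      \<comment> \<open>This choice of \<open>s\<close> gives the affine polynomial the value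
        -1.\<close>
      then show False
        using quad[of "- (inner f x + 1) / (2 * inner f y)"] True by (simp add: field_simps)
    qed
    then show ?thesis using True by simp
  next
    case False
    then have "0 < inner h y" using hy by simp
    then show ?thesis
      using quad[of "- inner f y / inner h y"] by (simp add: field_simps power2_eq_square)
  qed
qed

text \<open>Names the approximating pair behind \<open>form_domain\<close>, over an arbitrary real
  inner product space, so that the limit arguments are independent of \<open>l2\<close>.\<close>

definition form_approx ::
    "('h::real_inner \<times> 'h) set \<Rightarrow> 'h \<Rightarrow> (nat \<Rightarrow> 'h) \<Rightarrow> (nat \<Rightarrow> 'h) \<Rightarrow> bool" where
  "form_approx T u \<phi> \<psi> \<longleftrightarrow> (\<forall>n. (\<phi> n, \<psi> n) \<in> T) \<and> \<phi> \<longlonglongrightarrow> u \<and>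
     (\<forall>e>0. \<exists>M. \<forall>m\<ge>M. \<forall>n\<ge>M. inner (\<psi> m - \<psi> n) (\<phi> m - \<phi> n) < e)"

lemma form_domain_iff: "u \<in> form_domain T \<longleftrightarrow> (\<exists>\<phi> \<psi>. form_approx T u \<phi> \<psi>)"
  by (simp add: form_domain_def form_approx_def inner_l2_def)

text \<open>By Cauchy-Schwarz for the form, the difference is controlled by the form at
  \<open>\<phi> m - \<phi> k\<close>, which is small, times the form at \<open>\<phi>' n\<close>,
  which is eventually bounded because the second sequence is Cauchy for the form.\<close>

lemma form_approx_inner_diff:
  fixes T :: "('h::real_inner \<times> 'h) set"
  assumes T: "subspace T"
    and sym: "\<And>x f y h. (x, f) \<in> T \<Longrightarrow> (y, h) \<in> T \<Longrightarrow> inner f y = inner x h"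
    and pos: "\<And>x f. (x, f) \<in> T \<Longrightarrow> 0 \<le> inner f x"
    and u: "form_approx T u \<phi> \<psi>" and v: "form_approx T v \<phi>' \<psi>'"
    and e: "e > 0"
  shows "\<exists>M. \<forall>m\<ge>M. \<forall>k\<ge>M. \<forall>n\<ge>M. \<bar>inner (\<psi> m) (\<phi>' n) - inner (\<psi> k) (\<phi>' n)\<bar> < e"
proof -
  have inT: "(\<phi> n, \<psi> n) \<in> T" "(\<phi>' n, \<psi>' n) \<in> T" for n
    using u v by (auto simp: form_approx_def)
  have diffT: "(\<phi> m - \<phi> n, \<psi> m - \<psi> n) \<in> T" "(\<phi>' m - \<phi>' n, \<psi>' m - \<psi>' n) \<in> T" for m n
    using subspace_diff[OF T inT(1)[of m] inT(1)[of n]] subspace_diff[OF T inT(2)[of m] inT(2)[of n]]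
    by simp_all
  obtain N where N: "\<And>m n. m \<ge> N \<Longrightarrow> n \<ge> N \<Longrightarrow> inner (\<psi>' m - \<psi>' n) (\<phi>' m - \<phi>' n) < 1"
    using v unfolding form_approx_def by (meson zero_less_one)
  \<comment> \<open>\<open>K\<close> is 2 times the Cauchy tolerance 1 plus 2 times the form at
    \<open>\<phi>' N\<close>. It bounds the form at \<open>\<phi>' n\<close>, since the form is
    nonnegative at \<open>\<phi>' n - 2 *\<^sub>R \<phi>' N\<close>.\<close>
  define K where "K = 2 + 2 * inner (\<psi>' N) (\<phi>' N)"
  have K: "K > 0" using pos[OF inT(2)[of N]] by (simp add: K_def)
  have bound: "inner (\<psi>' n) (\<phi>' n) \<le> K" if "n \<ge> N" for n
  proof -
    have "(\<phi>' n, \<psi>' n) - 2 *\<^sub>R (\<phi>' N, \<psi>' N) \<in> T"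
      by (intro subspace_diff[OF T] subspace_scale[OF T] inT)
    then have "0 \<le> inner (\<psi>' n - 2 *\<^sub>R \<psi>' N) (\<phi>' n - 2 *\<^sub>R \<phi>' N)" using pos by simp
    with N[OF that order_refl] show ?thesis
      by (simp add: K_def inner_diff_left inner_diff_right)
  qed
  have "e\<^sup>2 / K > 0" using e K by simp
  then obtain M where M: "\<And>m n. m \<ge> M \<Longrightarrow> n \<ge> M \<Longrightarrow> inner (\<psi> m - \<psi> n) (\<phi> m - \<phi> n) < e\<^sup>2 / K"
    using u unfolding form_approx_def by meson
  have "\<bar>inner (\<psi> m) (\<phi>' n) - inner (\<psi> k) (\<phi>' n)\<bar> < e"
    if "m \<ge> max M N" "k \<ge> max M N" "n \<ge> max M N" for m k n
  proof -
    have "(inner (\<psi> m - \<psi> k) (\<phi>' n))\<^sup>2 \<le> inner (\<psi> m - \<psi> k) (\<phi> m - \<phi> k) * inner (\<psi>' n) (\<phi>' n)"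
      by (rule form_Cauchy_Schwarz[OF T sym pos diffT(1) inT(2)])
    also have "\<dots> \<le> inner (\<psi> m - \<psi> k) (\<phi> m - \<phi> k) * K"
      using that bound pos[OF diffT(1)] by (intro mult_left_mono) auto
    also have "\<dots> < e\<^sup>2"
      using M[of m k] that K by (simp add: field_simps)
    finally show ?thesis
      using e power2_less_imp_less[of "\<bar>inner (\<psi> m - \<psi> k) (\<phi>' n)\<bar>" e]
      by (simp add: inner_diff_left)
  qed
  then show ?thesis by blast
qed

text \<open>The double sequence \<open>inner (\<psi> m) (\<phi>' n)\<close> is Cauchy in both indices jointly, so its diagonal has the
  same limit as its iterated limit, which the adjoint relation evaluates.\<close>

lemma form_approx_adjoint_tendsto:
  fixes T :: "('h::real_inner \<times> 'h) set"
  assumes T: "subspace T"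
    and sym: "\<And>x f y h. (x, f) \<in> T \<Longrightarrow> (y, h) \<in> T \<Longrightarrow> inner f y = inner x h"
    and pos: "\<And>x f. (x, f) \<in> T \<Longrightarrow> 0 \<le> inner f x"
    and u: "form_approx T u \<phi> \<psi>" and v: "form_approx T v \<phi>' \<psi>'"
    and adj: "\<And>x f. (x, f) \<in> T \<Longrightarrow> inner v f = inner h x"
  shows "(\<lambda>n. inner (\<psi> n) (\<phi>' n)) \<longlonglongrightarrow> inner u h"
proof (rule LIMSEQ_I)
  fix e :: real assume "e > 0"
  then have e: "e / 4 > 0" by simp
  obtain M1 where M1: "\<And>m k n. m \<ge> M1 \<Longrightarrow> k \<ge> M1 \<Longrightarrow> n \<ge> M1 \<Longrightarrow>
      \<bar>inner (\<psi> m) (\<phi>' n) - inner (\<psi> k) (\<phi>' n)\<bar> < e / 4"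
    using form_approx_inner_diff[OF T sym pos u v e] by blast
  obtain M2 where M2: "\<And>m k n. m \<ge> M2 \<Longrightarrow> k \<ge> M2 \<Longrightarrow> n \<ge> M2 \<Longrightarrow>
      \<bar>inner (\<psi>' m) (\<phi> n) - inner (\<psi>' k) (\<phi> n)\<bar> < e / 4"
    using form_approx_inner_diff[OF T sym pos v u e] by blast
  have inT: "(\<phi> n, \<psi> n) \<in> T" "(\<phi>' n, \<psi>' n) \<in> T" for n
    using u v by (auto simp: form_approx_def)
  have swap: "inner (\<psi>' m) (\<phi> n) = inner (\<psi> n) (\<phi>' m)" for m n
    using sym[OF inT(2)[of m] inT(1)[of n]] by (simp add: inner_commute)
  have lim: "\<phi> \<longlonglongrightarrow> u" "\<phi>' \<longlonglongrightarrow> v" using u v by (auto simp: form_approx_def)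
  define M where "M = max M1 M2"
  have "norm (inner (\<psi> k) (\<phi>' k) - inner u h) < e" if k: "k \<ge> M" for k
  proof -
    have close: "\<bar>inner (\<psi> k) (\<phi>' k) - inner (\<psi> m) (\<phi>' n)\<bar> \<le> e / 2" if "m \<ge> M" "n \<ge> M" for m n
    proof -
      have "\<bar>inner (\<psi> k) (\<phi>' k) - inner (\<psi> m) (\<phi>' k)\<bar> < e / 4"
        using M1 that k by (simp add: M_def)
      \<comment> \<open>Moving the second index is the same estimate with the two sequences
        exchanged, read through \<open>swap\<close>.\<close>
      moreover have "\<bar>inner (\<psi> m) (\<phi>' k) - inner (\<psi> m) (\<phi>' n)\<bar> < e / 4"
        using M2[of k n m] that k by (simp add: M_def swap)
      ultimately show ?thesis using \<open>e > 0\<close> by linarith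
    qed
    have inner_h: "\<bar>inner (\<psi> k) (\<phi>' k) - inner (\<phi> m) h\<bar> \<le> e / 2" if m: "m \<ge> M" for m
    proof -
      have eq: "inner (\<psi> m) v = inner (\<phi> m) h"
        using adj[OF inT(1)[of m]] by (simp add: inner_commute)
      have "(\<lambda>n. \<bar>inner (\<psi> k) (\<phi>' k) - inner (\<psi> m) (\<phi>' n)\<bar>) \<longlonglongrightarrow> \<bar>inner (\<psi> k) (\<phi>' k) - inner (\<phi> m) h\<bar>"
        unfolding eq[symmetric] by (intro tendsto_intros lim)
      then show ?thesis
        by (rule LIMSEQ_le_const2) (use close m in auto)
    qed
    have "(\<lambda>m. \<bar>inner (\<psi> k) (\<phi>' k) - inner (\<phi> m) h\<bar>) \<longlonglongrightarrow> \<bar>inner (\<psi> k) (\<phi>' k) - inner u h\<bar>"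
      by (intro tendsto_intros lim)
    then have "\<bar>inner (\<psi> k) (\<phi>' k) - inner u h\<bar> \<le> e / 2"
      by (rule LIMSEQ_le_const2) (use inner_h in auto)
    then show ?thesis using \<open>e > 0\<close> by simp
  qed
  then show "\<exists>M. \<forall>k\<ge>M. norm (inner (\<psi> k) (\<phi>' k) - inner u h) < e"
    by blast
qed

section \<open>Linearity of the Friedrichs extension\<close>

lemma form_domain_add:
  fixes T :: "('a::euclidean_space l2 \<times> 'a l2) set"
  assumes T: "subspace T"
    and pos: "\<And>x f. (x, f) \<in> T \<Longrightarrow> 0 \<le> inner f x"
    and "u \<in> form_domain T" "v \<in> form_domain T"
  shows "u + v \<in> form_domain T"
proof -
  obtain \<phi> \<psi> \<phi>' \<psi>' where u: "form_approx T u \<phi> \<psi>" and v: "form_approx T v \<phi>' \<psi>'"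
    using assms(3,4) by (auto simp: form_domain_iff)
  have inT: "(\<phi> n, \<psi> n) \<in> T" "(\<phi>' n, \<psi>' n) \<in> T" for n
    using u v by (auto simp: form_approx_def)
  have "form_approx T (u + v) (\<lambda>n. \<phi> n + \<phi>' n) (\<lambda>n. \<psi> n + \<psi>' n)"
    unfolding form_approx_def
  proof (intro conjI allI impI)
    show "(\<phi> n + \<phi>' n, \<psi> n + \<psi>' n) \<in> T" for n
      using subspace_add[OF T inT(1)[of n] inT(2)[of n]] by simp
    show "(\<lambda>n. \<phi> n + \<phi>' n) \<longlonglongrightarrow> u + v"
      using u v by (intro tendsto_add) (auto simp: form_approx_def)
    fix e :: real assume "e > 0"
    then have e: "e / 4 > 0" by simp
    obtain M where M: "\<And>m n. m \<ge> M \<Longrightarrow> n \<ge> M \<Longrightarrow> inner (\<psi> m - \<psi> n) (\<phi> m - \<phi> n) < e / 4"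
      using u e unfolding form_approx_def by meson
    obtain M' where M': "\<And>m n. m \<ge> M' \<Longrightarrow> n \<ge> M' \<Longrightarrow> inner (\<psi>' m - \<psi>' n) (\<phi>' m - \<phi>' n) < e / 4"
      using v e unfolding form_approx_def by meson
    have "inner (\<psi> m + \<psi>' m - (\<psi> n + \<psi>' n)) (\<phi> m + \<phi>' m - (\<phi> n + \<phi>' n)) < e"
      if "m \<ge> max M M'" "n \<ge> max M M'" for m n
    proof -
      define p where "p = \<phi> m - \<phi> n" define p' where "p' = \<phi>' m - \<phi>' n"
      define q where "q = \<psi> m - \<psi> n" define q' where "q' = \<psi>' m - \<psi>' n"
      \<comment> \<open>Nonnegativity of the form at \<open>p - p'\<close> is the parallelogram
        bound: the form at \<open>p + p'\<close> is at most twice the sum of the forms at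
        \<open>p\<close> and \<open>p'\<close>.\<close>
      have "((\<phi> m, \<psi> m) - (\<phi> n, \<psi> n)) - ((\<phi>' m, \<psi>' m) - (\<phi>' n, \<psi>' n)) \<in> T"
        by (intro subspace_diff[OF T] inT)
      then have "0 \<le> inner (q - q') (p - p')"
        using pos by (simp add: p_def p'_def q_def q'_def)
      then have "inner (q + q') (p + p') \<le> 2 * inner q p + 2 * inner q' p'"
        by (simp add: inner_add_left inner_add_right inner_diff_left inner_diff_right)
      also have "\<dots> < e"
        using M[of m n] M'[of m n] that by (simp add: p_def p'_def q_def q'_def)
      finally show ?thesis
        by (simp add: p_def p'_def q_def q'_def algebra_simps)
    qed
    then show "\<exists>M. \<forall>m\<ge>M. \<forall>n\<ge>M.
        inner (\<psi> m + \<psi>' m - (\<psi> n + \<psi>' n)) (\<phi> m + \<phi>' m - (\<phi> n + \<phi>' n)) < e"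
      by blast
  qed
  then show ?thesis by (auto simp: form_domain_iff)
qed

lemma form_domain_scaleR:
  fixes T :: "('a::euclidean_space l2 \<times> 'a l2) set"
  assumes T: "subspace T" and "u \<in> form_domain T"
  shows "c *\<^sub>R u \<in> form_domain T"
proof -
  obtain \<phi> \<psi> where u: "form_approx T u \<phi> \<psi>"
    using assms(2) by (auto simp: form_domain_iff)
  have "form_approx T (c *\<^sub>R u) (\<lambda>n. c *\<^sub>R \<phi> n) (\<lambda>n. c *\<^sub>R \<psi> n)"
    unfolding form_approx_def
  proof (intro conjI allI impI)
    have inT: "(\<phi> n, \<psi> n) \<in> T" for n
      using u by (auto simp: form_approx_def)
    show "(c *\<^sub>R \<phi> n, c *\<^sub>R \<psi> n) \<in> T" for n
      using subspace_scale[OF T inT[of n], of c] by simp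
    show "(\<lambda>n. c *\<^sub>R \<phi> n) \<longlonglongrightarrow> c *\<^sub>R u"
      using u by (intro tendsto_intros) (auto simp: form_approx_def)
    fix e :: real assume "e > 0"
    \<comment> \<open>The summand 1 in the denominator covers \<open>c = 0\<close>.\<close>
    then have e: "e / (c\<^sup>2 + 1) > 0" by (simp add: add_nonneg_pos)
    obtain M where M: "\<And>m n. m \<ge> M \<Longrightarrow> n \<ge> M \<Longrightarrow> inner (\<psi> m - \<psi> n) (\<phi> m - \<phi> n) < e / (c\<^sup>2 + 1)"
      using u e unfolding form_approx_def by meson
    have "inner (c *\<^sub>R \<psi> m - c *\<^sub>R \<psi> n) (c *\<^sub>R \<phi> m - c *\<^sub>R \<phi> n) < e" if "m \<ge> M" "n \<ge> M" for m n
    proof -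
      have "inner (c *\<^sub>R \<psi> m - c *\<^sub>R \<psi> n) (c *\<^sub>R \<phi> m - c *\<^sub>R \<phi> n) =
          c\<^sup>2 * inner (\<psi> m - \<psi> n) (\<phi> m - \<phi> n)"
        by (simp add: power2_eq_square flip: scaleR_diff_right)
      also have "\<dots> \<le> c\<^sup>2 * (e / (c\<^sup>2 + 1))"
        using M[OF that] by (intro mult_left_mono) auto
      also have "\<dots> < e"
        using \<open>e > 0\<close> add_nonneg_pos[OF zero_le_power2[of c] zero_less_one]
        by (simp add: divide_less_eq algebra_simps)
      finally show ?thesis .
    qed
    then show "\<exists>M. \<forall>m\<ge>M. \<forall>n\<ge>M.
        inner (c *\<^sub>R \<psi> m - c *\<^sub>R \<psi> n) (c *\<^sub>R \<phi> m - c *\<^sub>R \<phi> n) < e"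
      by blast
  qed
  then show ?thesis by (auto simp: form_domain_iff)
qed

lemma subspace_adjoint_graph: "subspace (adjoint_graph T)"
proof (rule subspaceI)
  have z: "l2_inner 0 x = 0" for x :: "'a l2"
    using l2_inner_scaleR_left[of 0 0 x] by simp
  show "0 \<in> adjoint_graph T" by (auto simp: adjoint_graph_def zero_prod_def z)
  show "x + y \<in> adjoint_graph T" if "x \<in> adjoint_graph T" "y \<in> adjoint_graph T" for x y
    using that by (fastforce simp: adjoint_graph_def l2_inner_add_left)
  show "c *\<^sub>R x \<in> adjoint_graph T" if "x \<in> adjoint_graph T" for c x
    using that by (fastforce simp: adjoint_graph_def l2_inner_scaleR_left)
qed

lemma subspace_friedrichs_extension:
  fixes T :: "('a::euclidean_space l2 \<times> 'a l2) set"
  assumes T: "subspace T"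
    and pos: "\<And>x f. (x, f) \<in> T \<Longrightarrow> 0 \<le> inner f x"
  shows "subspace (friedrichs_extension T)"
proof (rule subspaceI)
  have "form_approx T 0 (\<lambda>_. 0) (\<lambda>_. 0)"
    using subspace_0[OF T] by (auto simp: form_approx_def zero_prod_def)
  then have "0 \<in> form_domain T" by (auto simp: form_domain_iff)
  then show "0 \<in> friedrichs_extension T"
    using subspace_0[OF subspace_adjoint_graph[of T]]
    by (simp add: friedrichs_extension_def zero_prod_def)
  show "x + y \<in> friedrichs_extension T" if "x \<in> friedrichs_extension T" "y \<in> friedrichs_extension T" for x y
    using that subspace_add[OF subspace_adjoint_graph[of T], of x y] form_domain_add[OF T pos, of "fst x" "fst y"]
    by (auto simp: friedrichs_extension_def)
  show "c *\<^sub>R x \<in> friedrichs_extension T" if "x \<in> friedrichs_extension T" for c x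
    using that subspace_scale[OF subspace_adjoint_graph[of T], of x c] form_domain_scaleR[OF T, of "fst x" c]
    by (auto simp: friedrichs_extension_def)
qed

section \<open>Symmetry and form inequalities carried over to the extension\<close>

text \<open>Taking real parts turns the complex adjoint relation into one for \<open>inner\<close>,
  the structure in which the abstract estimates are stated.\<close>

lemma friedrichs_extensionE:
  assumes "(u, f) \<in> friedrichs_extension T"
  obtains \<phi> \<psi> where "form_approx T u \<phi> \<psi>" "\<And>x h. (x, h) \<in> T \<Longrightarrow> inner u h = inner f x"
proof -
  obtain \<phi> \<psi> where "form_approx T u \<phi> \<psi>"
    using assms by (auto simp: friedrichs_extension_def form_domain_iff)
  moreover have "inner u h = inner f x" if "(x, h) \<in> T" for x h
    using assms that by (auto simp: friedrichs_extension_def adjoint_graph_def inner_l2_def)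
  ultimately show ?thesis using that by blast
qed

text \<open>The diagonal sequence \<open>inner (\<psi> n) (\<phi>' n)\<close> tends to
  \<open>inner u h\<close>; by symmetry of \<open>T\<close> it equals the diagonal with the roles of
  \<open>u\<close> and \<open>v\<close> exchanged, which tends to \<open>inner v f\<close>.\<close>

lemma friedrichs_extension_symmetric:
  fixes T :: "('a::euclidean_space l2 \<times> 'a l2) set"
  assumes T: "subspace T"
    and sym: "\<And>x f y h. (x, f) \<in> T \<Longrightarrow> (y, h) \<in> T \<Longrightarrow> inner f y = inner x h"
    and pos: "\<And>x f. (x, f) \<in> T \<Longrightarrow> 0 \<le> inner f x"
    and uf: "(u, f) \<in> friedrichs_extension T" and vh: "(v, h) \<in> friedrichs_extension T"
  shows "inner f v = inner u h"
proof -
  obtain \<phi> \<psi> where u: "form_approx T u \<phi> \<psi>" "\<And>x h. (x, h) \<in> T \<Longrightarrow> inner u h = inner f x"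
    using friedrichs_extensionE[OF uf] by blast
  obtain \<phi>' \<psi>' where v: "form_approx T v \<phi>' \<psi>'" "\<And>x f. (x, f) \<in> T \<Longrightarrow> inner v f = inner h x"
    using friedrichs_extensionE[OF vh] by blast
  have "inner (\<psi>' n) (\<phi> n) = inner (\<psi> n) (\<phi>' n)" for n
    using sym[of "\<phi> n" "\<psi> n" "\<phi>' n" "\<psi>' n"] u(1) v(1) by (simp add: form_approx_def inner_commute)
  then have "(\<lambda>n. inner (\<psi> n) (\<phi>' n)) \<longlonglongrightarrow> inner v f"
    using form_approx_adjoint_tendsto[OF T sym pos v(1) u] by simp
  then have "inner v f = inner u h"
    by (rule LIMSEQ_unique[OF _ form_approx_adjoint_tendsto[OF T sym pos u(1) v]])
  then show ?thesis by (simp add: inner_commute)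
qed

text \<open>With both approximating sequences equal, the diagonal limit evaluates the form at
  \<open>u\<close> as \<open>inner u f\<close>, so the inequality on \<open>T\<close> passes to the
  limit.\<close>

lemma friedrichs_extension_form_bound:
  fixes T :: "('a::euclidean_space l2 \<times> 'a l2) set"
  assumes T: "subspace T"
    and sym: "\<And>x f y h. (x, f) \<in> T \<Longrightarrow> (y, h) \<in> T \<Longrightarrow> inner f y = inner x h"
    and pos: "\<And>x f. (x, f) \<in> T \<Longrightarrow> 0 \<le> inner f x"
    and bound: "\<And>x f. (x, f) \<in> T \<Longrightarrow> (inner g x)\<^sup>2 \<le> C * inner f x"
    and uf: "(u, f) \<in> friedrichs_extension T"
  shows "(inner g u)\<^sup>2 \<le> C * inner f u"
proof -
  obtain \<phi> \<psi> where u: "form_approx T u \<phi> \<psi>" "\<And>x h. (x, h) \<in> T \<Longrightarrow> inner u h = inner f x"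
    using friedrichs_extensionE[OF uf] by blast
  have "(\<lambda>n. C * inner (\<psi> n) (\<phi> n)) \<longlonglongrightarrow> C * inner u f"
    by (intro tendsto_mult_left form_approx_adjoint_tendsto[OF T sym pos u(1) u])
  moreover have "(\<lambda>n. (inner g (\<phi> n))\<^sup>2) \<longlonglongrightarrow> (inner g u)\<^sup>2"
    using u(1) by (intro tendsto_intros) (auto simp: form_approx_def)
  ultimately have "(inner g u)\<^sup>2 \<le> C * inner u f"
    by (intro LIMSEQ_le[of "\<lambda>n. (inner g (\<phi> n))\<^sup>2" _ "\<lambda>n. C * inner (\<psi> n) (\<phi> n)"]) (use bound u(1) in \<open>auto simp: form_approx_def\<close>)
  then show ?thesis by (simp add: inner_commute)
qed

section \<open>Integration by parts and test functions\<close>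

lemma integrable_compact_support:
  fixes f :: "'a::euclidean_space \<Rightarrow> 'b::{banach, second_countable_topology}"
  assumes "continuous_on UNIV f" "compact K" "\<And>x. x \<notin> K \<Longrightarrow> f x = 0"
  shows "integrable lborel f"
proof -
  have "integrable lborel (\<lambda>x. indicator K x *\<^sub>R f x)"
    using assms by (intro borel_integrable_compact) (auto intro: continuous_on_subset)
  also have "(\<lambda>x. indicator K x *\<^sub>R f x) = f"
    using assms(3) by (auto simp: indicator_def fun_eq_iff)
  finally show ?thesis .
qed

lemma integral_translation:
  fixes f :: "'a::euclidean_space \<Rightarrow> real"
  assumes "f \<in> borel_measurable borel"
  shows "(\<integral>x. f (c + x) \<partial>lborel) = (\<integral>x. f x \<partial>lborel)"
  using integral_distr[of "(+) c" lborel borel f] assms by (simp add: lborel_distr_plus)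

text \<open>Difference quotients in direction \<open>b\<close> integrate to 0 by translation
  invariance. They converge to \<open>F'\<close>, and the mean value theorem dominates them by a
  constant on a fixed ball.\<close>

lemma integral_directional_derivative:
  fixes F F' :: "'a::euclidean_space \<Rightarrow> real"
  assumes F: "continuous_on UNIV F" and F': "continuous_on UNIV F'"
    and K: "compact K" "\<And>x. x \<notin> K \<Longrightarrow> F x = 0" "\<And>x. x \<notin> K \<Longrightarrow> F' x = 0"
    and deriv: "\<And>x. ((\<lambda>t. F (x + t *\<^sub>R b)) has_vector_derivative F' x) (at 0)"
  shows "integrable lborel F'" "(\<integral>x. F' x \<partial>lborel) = 0"
proof -
  have deriv_at: "((\<lambda>t. F (x + t *\<^sub>R b)) has_real_derivative F' (x + t *\<^sub>R b)) (at t)" for x t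
  proof -
    have "((\<lambda>s. F ((x + t *\<^sub>R b) + s *\<^sub>R b)) has_real_derivative F' (x + t *\<^sub>R b)) (at 0)"
      using deriv by (simp add: has_real_derivative_iff_has_vector_derivative)
    then show ?thesis
      using DERIV_shift[of "\<lambda>s. F (x + s *\<^sub>R b)" "F' (x + t *\<^sub>R b)" 0 t]
      by (simp add: scaleR_add_left add_ac)
  qed
  obtain R where R: "\<And>x. x \<in> K \<Longrightarrow> norm x \<le> R"
    using compact_imp_bounded[OF K(1)] by (auto simp: bounded_iff)
  have "bounded (F' ` K)"
    using K(1) F' by (intro compact_imp_bounded compact_continuous_image) (auto intro: continuous_on_subset)
  then obtain B where "\<And>x. x \<in> K \<Longrightarrow> \<bar>F' x\<bar> \<le> B"
    by (auto simp: bounded_iff)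
  \<comment> \<open>The absolute value of \<open>B\<close> matters when \<open>K\<close> is empty,
    since \<open>B\<close> is then arbitrary.\<close>
  then have B: "\<bar>F' x\<bar> \<le> \<bar>B\<bar>" for x
    using K(3)[of x] by (cases "x \<in> K") force+
  define h where "h n = 1 / real (Suc n)" for n
  have h: "0 < h n" "h n \<le> 1" for n by (auto simp: h_def)
  define s where "s n x = (F (x + h n *\<^sub>R b) - F x) / h n" for n x
  \<comment> \<open>Steps have length at most \<open>norm b\<close>, as \<open>h n \<le> 1\<close>;
    so outside this ball neither \<open>x\<close> nor the shifted point lies in
    \<open>K\<close>.\<close>
  define W where "W = cball (0::'a) (R + norm b)"
  have lim: "(\<lambda>n. s n x) \<longlonglongrightarrow> F' x" for x
  proof -
    have "((\<lambda>t. (F (x + t *\<^sub>R b) - F x) / t) \<longlongrightarrow> F' x) (at 0)"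
      using deriv_at[of x 0] by (simp add: DERIV_def)
    moreover have "filterlim h (at 0) sequentially"
    proof -
      have "h \<longlonglongrightarrow> 0"
        using LIMSEQ_inverse_real_of_nat unfolding h_def inverse_eq_divide .
      moreover have "h n \<noteq> 0" for n using h(1)[of n] by simp
      ultimately show ?thesis by (simp add: filterlim_at)
    qed
    ultimately show ?thesis
      unfolding s_def by (rule filterlim_compose)
  qed
  have bound: "norm (s n x) \<le> indicator W x * \<bar>B\<bar>" for n x
  proof (cases "x \<in> W")
    case True
    obtain z where "F (x + h n *\<^sub>R b) - F (x + 0 *\<^sub>R b) = (h n - 0) * F' (x + z *\<^sub>R b)"
      using MVT2[OF h(1) deriv_at] by blast
    then have "s n x = F' (x + z *\<^sub>R b)" using h(1)[of n] by (simp add: s_def)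
    then show ?thesis using B True by simp
  next
    case False
    then have big: "norm x > R + norm b" by (simp add: W_def)
    have "norm x \<le> norm (x + h n *\<^sub>R b) + h n * norm b"
      using norm_triangle_ineq4[of "x + h n *\<^sub>R b" "h n *\<^sub>R b"] h(1)[of n] by simp
    moreover have "h n * norm b \<le> norm b"
      using h[of n] by (simp add: mult_left_le_one_le)
    ultimately have "norm (x + h n *\<^sub>R b) > R" using big by linarith
    moreover have "norm x > R" using big norm_ge_zero[of b] by linarith
    ultimately have "F (x + h n *\<^sub>R b) = 0" "F x = 0"
      using K(2) R by (force simp: not_le)+
    then show ?thesis by (simp add: s_def)
  qed
  have Fm [measurable]: "F \<in> borel_measurable borel" "F' \<in> borel_measurable borel"
    using F F' by (auto intro: borel_measurable_continuous_onI)
  have Fint: "integrable lborel F" by (rule integrable_compact_support[OF F K(1,2)])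
  have Fshift: "integrable lborel (\<lambda>x. F (c + x))" for c
    using integrable_distr[of "(+) c" lborel borel F] Fint by (simp add: lborel_distr_plus)
  have s0: "(\<integral>x. s n x \<partial>lborel) = 0" for n
    unfolding s_def using integral_translation[of F "h n *\<^sub>R b"] Fint Fshift[of "h n *\<^sub>R b"]
    by (simp add: add.commute)
  have ms: "s n \<in> borel_measurable lborel" for n unfolding s_def by measurable
  have w: "integrable lborel (\<lambda>x. indicator W x * \<bar>B\<bar>)"
    by (intro integrable_mult_left integrable_real_indicator) (auto simp: W_def emeasure_bounded_finite[unfolded infinity_ennreal_def])
  note conv = integral_dominated_convergence[of F' lborel s, OF _ ms w] integrable_dominated_convergence[of F' lborel s, OF _ ms w]
  show "integrable lborel F'" by (rule conv(2)) (use lim bound in auto)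
  have "(\<lambda>n. \<integral>x. s n x \<partial>lborel) \<longlonglongrightarrow> (\<integral>x. F' x \<partial>lborel)"
    by (rule conv(1)) (use lim bound in auto)
  then show "(\<integral>x. F' x \<partial>lborel) = 0" using LIMSEQ_unique[OF tendsto_const] by (force simp: s0)
qed

lemma square_integrable_compact_support:
  assumes "continuous_on UNIV f" "compact K" "\<And>x. x \<notin> K \<Longrightarrow> f x = 0"
  shows "square_integrable f"
proof -
  have "f \<in> borel_measurable borel"
    using assms(1) by (rule borel_measurable_continuous_onI)
  moreover have "integrable lborel (\<lambda>x. (cmod (f x))\<^sup>2)"
    by (rule integrable_compact_support[OF _ assms(2)]) (use assms in \<open>auto intro!: continuous_intros\<close>)
  ultimately show ?thesis by (simp add: square_integrable_def)
qed

lemma inner_abs_l2: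
  assumes "square_integrable f" "square_integrable g"
  shows "inner (abs_l2 f) (abs_l2 g) = (\<integral>x. inner (f x) (g x) \<partial>lborel)"
proof -
  have "l2_inner (abs_l2 f) (abs_l2 g) = (\<integral>x. f x * cnj (g x) \<partial>lborel)"
    using assms by (intro l2_inner.abs_eq) (auto simp: l2_rel_def)
  then have "inner (abs_l2 f) (abs_l2 g) = (\<integral>x. Re (f x * cnj (g x)) \<partial>lborel)"
    using square_integrable_mult[OF assms] by (simp only: inner_l2_def integral_Re)
  then show ?thesis by (simp add: inner_complex_def)
qed

text \<open>The space is covered by two open sets: the punctured space, where both factors are
  continuous, and the complement of \<open>K\<close>, where the product is 0. A singularity of
  \<open>h\<close> at \<open>p\<close> is thereby harmless.\<close>

lemma continuous_on_mult_vanishing: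
  fixes f h :: "'a::t1_space \<Rightarrow> 'b::real_normed_algebra"
  assumes "continuous_on (- {p}) h" "continuous_on UNIV f" "closed K" "p \<notin> K" "\<And>x. x \<notin> K \<Longrightarrow> f x = 0"
  shows "continuous_on UNIV (\<lambda>x. h x * f x)"
proof -
  have "continuous_on (- {p} \<union> - K) (\<lambda>x. h x * f x)"
  proof (rule continuous_on_open_Un)
    show "continuous_on (- {p}) (\<lambda>x. h x * f x)"
      by (intro continuous_on_mult assms continuous_on_subset[OF assms(2)]) auto
    have "continuous_on (- K) (\<lambda>x. 0::'b)" by simp
    then show "continuous_on (- K) (\<lambda>x. h x * f x)"
      by (rule continuous_on_eq) (use assms in auto)
  qed (use assms in auto)
  moreover have "- {p} \<union> - K = UNIV" using assms(4) by auto
  ultimately show ?thesis by simp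
qed

section \<open>Partial derivatives and the space of test functions\<close>

lemma has_vector_derivative_partial_deriv:
  assumes "f differentiable at x"
  shows "((\<lambda>t. f (x + t *\<^sub>R b)) has_vector_derivative partial_deriv b f x) (at 0)"
proof -
  have D: "(f has_derivative frechet_derivative f (at x)) (at x)"
    using assms by (simp add: frechet_derivative_works)
  have "((f \<circ> (\<lambda>t. x + t *\<^sub>R b)) has_derivative (frechet_derivative f (at x) \<circ> (\<lambda>t. t *\<^sub>R b))) (at 0)"
    by (rule diff_chain_at) (use D in \<open>auto intro!: derivative_eq_intros\<close>)
  then show ?thesis
    using linear_scale[OF has_derivative_linear[OF D]]
    by (simp add: has_vector_derivative_def o_def partial_deriv_def)
qed

lemma partial_deriv_eqI:
  assumes "(f has_derivative D) (at x)"
  shows "partial_deriv b f x = D b"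
  using frechet_derivative_at[OF assms] by (simp add: partial_deriv_def)

lemma partial_deriv_vanishing:
  assumes "closed K" "\<And>x. x \<notin> K \<Longrightarrow> f x = 0" "x \<notin> K"
  shows "partial_deriv b f x = 0"
proof -
  have "(f has_derivative (\<lambda>_. 0)) (at x)"
    by (rule has_derivative_transform_within_open[of "\<lambda>_. 0" _ _ _ "- K"]) (use assms in auto)
  then show ?thesis by (rule partial_deriv_eqI)
qed

lemma partial_deriv_add:
  assumes "f differentiable at x" "g differentiable at x"
  shows "partial_deriv b (\<lambda>x. f x + g x) x = partial_deriv b f x + partial_deriv b g x"
  using assms
  by (subst partial_deriv_eqI[OF has_derivative_add]) (auto simp: frechet_derivative_works partial_deriv_def)

lemma partial_deriv_scaleR:
  assumes "f differentiable at x"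
  shows "partial_deriv b (\<lambda>x. c *\<^sub>R f x) x = c *\<^sub>R partial_deriv b f x"
  using assms
  by (subst partial_deriv_eqI[OF has_derivative_scaleR_right]) (auto simp: frechet_derivative_works partial_deriv_def)

lemma Ck_add: "Ck k f \<Longrightarrow> Ck k g \<Longrightarrow> Ck k (\<lambda>x. f x + g x)"
proof (induction k arbitrary: f g)
  case 0
  then show ?case by (auto intro: continuous_intros)
next
  case (Suc k)
  then have d: "f differentiable at x" "g differentiable at x" for x
    by (auto simp: differentiable_on_def)
  then have "partial_deriv b (\<lambda>x. f x + g x) = (\<lambda>x. partial_deriv b f x + partial_deriv b g x)" for b
    by (auto simp: partial_deriv_add)
  with Suc d show ?case by (auto simp: differentiable_on_def)
qed

lemma Ck_scaleR: "Ck k f \<Longrightarrow> Ck k (\<lambda>x. c *\<^sub>R f x)"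
proof (induction k arbitrary: f)
  case 0
  then show ?case by (auto intro: continuous_intros)
next
  case (Suc k)
  then have d: "f differentiable at x" for x
    by (auto simp: differentiable_on_def)
  then have "partial_deriv b (\<lambda>x. c *\<^sub>R f x) = (\<lambda>x. c *\<^sub>R partial_deriv b f x)" for b
    by (auto simp: partial_deriv_scaleR)
  with Suc d show ?case by (auto simp: differentiable_on_def)
qed

lemma Ck_0: "Ck k (\<lambda>x. 0)"
proof (induction k)
  case (Suc k)
  have "partial_deriv b (\<lambda>x::'a. 0) = (\<lambda>x. 0)" for b
    by (intro ext partial_deriv_eqI) auto
  with Suc show ?case by (auto simp: differentiable_on_def)
qed auto

lemma test_functions_0: "(\<lambda>x. 0) \<in> test_functions \<Omega>"
  by (simp add: test_functions_def Ck_0)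

lemma test_functions_add:
  assumes "\<phi> \<in> test_functions \<Omega>" "\<xi> \<in> test_functions \<Omega>"
  shows "(\<lambda>x. \<phi> x + \<xi> x) \<in> test_functions \<Omega>"
proof -
  have sub: "closure {x. \<phi> x + \<xi> x \<noteq> 0} \<subseteq> closure {x. \<phi> x \<noteq> 0} \<union> closure {x. \<xi> x \<noteq> 0}"
    unfolding closure_Un[symmetric] by (rule closure_mono) auto
  have "compact (closure {x. \<phi> x \<noteq> 0} \<union> closure {x. \<xi> x \<noteq> 0})"
    using assms by (intro compact_Un) (auto simp: test_functions_def)
  from compact_Int_closed[OF this closed_closure, of "{x. \<phi> x + \<xi> x \<noteq> 0}"] sub
  have "compact (closure {x. \<phi> x + \<xi> x \<noteq> 0})" by (simp add: Int_absorb1)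
  with sub show ?thesis using assms by (auto simp: test_functions_def intro!: Ck_add)
qed

lemma test_functions_scaleR:
  assumes "\<phi> \<in> test_functions \<Omega>"
  shows "(\<lambda>x. c *\<^sub>R \<phi> x) \<in> test_functions \<Omega>"
proof (cases "c = 0")
  case True
  then show ?thesis by (simp add: test_functions_0)
next
  case False
  then show ?thesis using assms by (auto simp: test_functions_def intro!: Ck_scaleR)
qed

lemma test_function_continuous:
  assumes "\<phi> \<in> test_functions \<Omega>"
  shows "continuous_on UNIV \<phi>"
  using assms Ck.simps(1) unfolding test_functions_def by blast

lemma test_function_differentiable:
  assumes "\<phi> \<in> test_functions \<Omega>"
  shows "\<phi> differentiable at x"
proof -
  have "Ck (Suc 0) \<phi>" using assms unfolding test_functions_def by blast
  then show ?thesis by (simp add: differentiable_on_def)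
qed

lemma test_functions_partial_deriv:
  assumes \<phi>: "\<phi> \<in> test_functions \<Omega>" and b: "b \<in> Basis"
  shows "partial_deriv b \<phi> \<in> test_functions \<Omega>"
proof -
  have "partial_deriv b \<phi> x = 0" if "x \<notin> closure {x. \<phi> x \<noteq> 0}" for x
    by (rule partial_deriv_vanishing[OF closed_closure _ that])
       (use closure_subset[of "{x. \<phi> x \<noteq> 0}"] in auto)
  then have sub: "closure {x. partial_deriv b \<phi> x \<noteq> 0} \<subseteq> closure {x. \<phi> x \<noteq> 0}"
    by (intro closure_minimal) auto
  have "compact (closure {x. \<phi> x \<noteq> 0})" using \<phi> by (simp add: test_functions_def)
  from compact_Int_closed[OF this closed_closure, of "{x. partial_deriv b \<phi> x \<noteq> 0}"] sub
  have "compact (closure {x. partial_deriv b \<phi> x \<noteq> 0})" by (simp add: Int_absorb1)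
  moreover have "Ck k (partial_deriv b \<phi>)" for k
  proof -
    have "Ck (Suc k) \<phi>" using \<phi> unfolding test_functions_def by blast
    then show ?thesis using b by simp
  qed
  ultimately show ?thesis using \<phi> sub by (auto simp: test_functions_def)
qed

lemma test_functions_sum:
  assumes "\<And>i. i \<in> I \<Longrightarrow> f i \<in> test_functions \<Omega>"
  shows "(\<lambda>x. \<Sum>i\<in>I. f i x) \<in> test_functions \<Omega>"
  using assms by (induction I rule: infinite_finite_induct) (auto simp: test_functions_0 test_functions_add)

lemma test_functions_laplacian:
  assumes "\<phi> \<in> test_functions \<Omega>"
  shows "laplacian \<phi> \<in> test_functions \<Omega>"
  unfolding laplacian_def using assms
  by (intro test_functions_sum test_functions_partial_deriv)

lemma laplacian_add:
  assumes "\<phi> \<in> test_functions \<Omega>" "\<xi> \<in> test_functions \<Omega>"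
  shows "laplacian (\<lambda>x. \<phi> x + \<xi> x) x = laplacian \<phi> x + laplacian \<xi> x"
proof -
  have "partial_deriv b (partial_deriv b (\<lambda>x. \<phi> x + \<xi> x)) x =
      partial_deriv b (partial_deriv b \<phi>) x + partial_deriv b (partial_deriv b \<xi>) x" if "b \<in> Basis" for b
  proof -
    have "partial_deriv b (\<lambda>x. \<phi> x + \<xi> x) = (\<lambda>x. partial_deriv b \<phi> x + partial_deriv b \<xi> x)"
      using assms by (intro ext partial_deriv_add test_function_differentiable)
    then show ?thesis
      using assms that
      by (simp add: partial_deriv_add test_function_differentiable[OF test_functions_partial_deriv])
  qed
  then show ?thesis by (simp add: laplacian_def sum.distrib)
qed

lemma laplacian_scaleR:
  assumes "\<phi> \<in> test_functions \<Omega>"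
  shows "laplacian (\<lambda>x. c *\<^sub>R \<phi> x) x = c *\<^sub>R laplacian \<phi> x"
proof -
  have "partial_deriv b (partial_deriv b (\<lambda>x. c *\<^sub>R \<phi> x)) x = c *\<^sub>R partial_deriv b (partial_deriv b \<phi>) x"
    if "b \<in> Basis" for b
  proof -
    have "partial_deriv b (\<lambda>x. c *\<^sub>R \<phi> x) = (\<lambda>x. c *\<^sub>R partial_deriv b \<phi> x)"
      using assms by (intro ext partial_deriv_scaleR test_function_differentiable)
    then show ?thesis
      using assms that
      by (simp add: partial_deriv_scaleR test_function_differentiable[OF test_functions_partial_deriv])
  qed
  then show ?thesis by (simp add: laplacian_def scaleR_sum_right)
qed

section \<open>The inverse-square potential\<close>

text \<open>The closed support serves as \<open>K\<close> for all derivatives at once: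
  \<open>\<phi>\<close> is identically 0 on its open complement.\<close>

lemma test_function_support_away_0:
  assumes "\<phi> \<in> test_functions (UNIV - {0})"
  obtains K where "compact K" "0 \<notin> K" "\<And>x. x \<notin> K \<Longrightarrow> \<phi> x = 0"
    "\<And>x b. x \<notin> K \<Longrightarrow> partial_deriv b \<phi> x = 0"
    "\<And>x. x \<notin> K \<Longrightarrow> laplacian \<phi> x = 0"
proof -
  define K where "K = closure {x. \<phi> x \<noteq> 0}"
  have d0: "\<phi> x = 0" if "x \<notin> K" for x
    using that closure_subset[of "{x. \<phi> x \<noteq> 0}"] by (auto simp: K_def)
  have cl: "closed K" by (simp add: K_def)
  have d1: "partial_deriv b \<phi> x = 0" if "x \<notin> K" for x b
    by (rule partial_deriv_vanishing[OF cl d0 that])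
  have "partial_deriv b (partial_deriv b \<phi>) x = 0" if "x \<notin> K" for x b
    by (rule partial_deriv_vanishing[OF cl d1 that])
  then have "laplacian \<phi> x = 0" if "x \<notin> K" for x
    using that by (simp add: laplacian_def)
  moreover have "compact K" "0 \<notin> K" using assms by (auto simp: test_functions_def K_def)
  ultimately show ?thesis using that d0 d1 by blast
qed

lemma continuous_on_mult_test_function:
  fixes f :: "'a::euclidean_space \<Rightarrow> 'b::real_normed_algebra"
  assumes "\<phi> \<in> test_functions (UNIV - {0})" "continuous_on (- {0}) h" "continuous_on UNIV f"
    "\<And>x. \<phi> x = 0 \<Longrightarrow> f x = 0"
  shows "continuous_on UNIV (\<lambda>x. h x * f x)"
proof -
  obtain K where "compact K" "0 \<notin> K" "\<And>x. x \<notin> K \<Longrightarrow> \<phi> x = 0"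
    using test_function_support_away_0[OF assms(1)] by metis
  then show ?thesis
    using assms by (intro continuous_on_mult_vanishing[of 0 h f K]) (auto simp: compact_imp_closed)
qed

definition inverse_square_action :: "real \<Rightarrow> ('a::euclidean_space \<Rightarrow> complex) \<Rightarrow> 'a \<Rightarrow> complex" where
  "inverse_square_action a \<phi> x = - laplacian \<phi> x + of_real (a / (norm x)\<^sup>2) * \<phi> x"

text \<open>In this form the potential is a real scalar, which the rules for the real inner product
  can pull out.\<close>

lemma inverse_square_action_scaleR:
  "inverse_square_action a \<phi> x = - laplacian \<phi> x + (a / (norm x)\<^sup>2) *\<^sub>R \<phi> x"
  by (simp add: inverse_square_action_def scaleR_conv_of_real)

lemma inverse_square_minimal_eq:
  "inverse_square_minimal a =
    (\<lambda>\<phi>. (abs_l2 \<phi>, abs_l2 (inverse_square_action a \<phi>))) ` test_functions (UNIV - {0})"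
  unfolding inverse_square_minimal_def inverse_square_action_def[abs_def] ..

lemma continuous_inverse_square_action:
  assumes "\<phi> \<in> test_functions (UNIV - {0})"
  shows "continuous_on UNIV (inverse_square_action a \<phi>)"
  unfolding inverse_square_action_def[abs_def]
  using assms
  by (intro continuous_on_add continuous_on_minus continuous_on_mult_test_function
        test_function_continuous[OF test_functions_laplacian] test_function_continuous)
     (auto intro!: continuous_intros)

lemma square_integrable_test_function:
  assumes "\<phi> \<in> test_functions \<Omega>"
  shows "square_integrable \<phi>"
  by (rule square_integrable_compact_support[of _ "closure {x. \<phi> x \<noteq> 0}"])
     (use assms test_function_continuous closure_subset[of "{x. \<phi> x \<noteq> 0}"] in \<open>auto simp: test_functions_def\<close>)

lemma square_integrable_inverse_square_action:
  assumes "\<phi> \<in> test_functions (UNIV - {0})"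
  shows "square_integrable (inverse_square_action a \<phi>)"
proof -
  obtain K where "compact K" "\<And>x. x \<notin> K \<Longrightarrow> \<phi> x = 0" "\<And>x. x \<notin> K \<Longrightarrow> laplacian \<phi> x = 0"
    using test_function_support_away_0[OF assms] by metis
  then show ?thesis
    by (intro square_integrable_compact_support[of _ K] continuous_inverse_square_action assms)
       (auto simp: inverse_square_action_def)
qed

lemma abs_l2_add:
  assumes "square_integrable f" "square_integrable g"
  shows "abs_l2 f + abs_l2 g = abs_l2 (\<lambda>x. f x + g x)"
  using assms by (intro plus_l2.abs_eq) (auto simp: l2_rel_def)

lemma abs_l2_scaleR:
  assumes "square_integrable f"
  shows "c *\<^sub>R abs_l2 f = abs_l2 (\<lambda>x. c *\<^sub>R f x)"
  using assms by (intro scaleR_l2.abs_eq) (auto simp: l2_rel_def)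

lemma subspace_inverse_square_minimal:
  "subspace (inverse_square_minimal a :: ('a::euclidean_space l2 \<times> 'a l2) set)"
proof (rule subspaceI)
  let ?T = "inverse_square_minimal a :: ('a l2 \<times> 'a l2) set"
  have scale: "c *\<^sub>R p \<in> ?T" if p: "p \<in> ?T" for c p
  proof -
    obtain \<phi> where \<phi>: "\<phi> \<in> test_functions (UNIV - {0})"
      and p: "p = (abs_l2 \<phi>, abs_l2 (inverse_square_action a \<phi>))"
      using p by (auto simp: inverse_square_minimal_eq)
    have "(\<lambda>x. c *\<^sub>R inverse_square_action a \<phi> x) = inverse_square_action a (\<lambda>x. c *\<^sub>R \<phi> x)"
      using \<phi> by (auto simp: inverse_square_action_def laplacian_scaleR scaleR_diff_right)
    then have "c *\<^sub>R p = (abs_l2 (\<lambda>x. c *\<^sub>R \<phi> x), abs_l2 (inverse_square_action a (\<lambda>x. c *\<^sub>R \<phi> x)))"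
      using \<phi> by (simp add: p abs_l2_scaleR square_integrable_test_function square_integrable_inverse_square_action)
    then show ?thesis
      using test_functions_scaleR[OF \<phi>, of c] by (auto simp: inverse_square_minimal_eq)
  qed
  have "?T \<noteq> {}" using test_functions_0 by (auto simp: inverse_square_minimal_eq)
  then obtain p where "p \<in> ?T" by blast
  then show "0 \<in> ?T" using scale[of p 0] by simp
  show "c *\<^sub>R p \<in> ?T" if "p \<in> ?T" for c p using scale that .
  show "p + q \<in> ?T" if pq: "p \<in> ?T" "q \<in> ?T" for p q
  proof -
    obtain \<phi> \<xi> where \<phi>: "\<phi> \<in> test_functions (UNIV - {0})" and \<xi>: "\<xi> \<in> test_functions (UNIV - {0})"
      and p: "p = (abs_l2 \<phi>, abs_l2 (inverse_square_action a \<phi>))"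
      and q: "q = (abs_l2 \<xi>, abs_l2 (inverse_square_action a \<xi>))"
      using pq by (auto simp: inverse_square_minimal_eq)
    have "(\<lambda>x. inverse_square_action a \<phi> x + inverse_square_action a \<xi> x) =
        inverse_square_action a (\<lambda>x. \<phi> x + \<xi> x)"
      using \<phi> \<xi> by (auto simp: fun_eq_iff inverse_square_action_scaleR laplacian_add scaleR_add_right)
    then have "p + q = (abs_l2 (\<lambda>x. \<phi> x + \<xi> x), abs_l2 (inverse_square_action a (\<lambda>x. \<phi> x + \<xi> x)))"
      using \<phi> \<xi>
      by (simp add: p q abs_l2_add square_integrable_test_function square_integrable_inverse_square_action)
    then show ?thesis
      using test_functions_add[OF \<phi> \<xi>] by (auto simp: inverse_square_minimal_eq)
  qed
qed

section \<open>Symmetry, Hardy's inequality and the weighted Cauchy-Schwarz bound\<close>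

lemma has_vector_derivative_partial_deriv_test:
  assumes "\<phi> \<in> test_functions \<Omega>"
  shows "((\<lambda>t. \<phi> (x + t *\<^sub>R b)) has_vector_derivative partial_deriv b \<phi> x) (at 0)"
  by (rule has_vector_derivative_partial_deriv[OF test_function_differentiable[OF assms]])

lemma integrable_inner_square_integrable:
  assumes "square_integrable f" "square_integrable g"
  shows "integrable lborel (\<lambda>x. inner (f x) (g x))"
  using integrable_Re[OF square_integrable_mult[OF assms]] by (simp add: inner_complex_def)

text \<open>The difference of the two integrands is minus the divergence of
  \<open>inner (\<nabla>\<phi>) \<xi> - inner \<phi> (\<nabla>\<xi>)\<close>.\<close>

lemma inverse_square_action_symmetric:
  fixes \<phi> \<xi> :: "'a::euclidean_space \<Rightarrow> complex"
  assumes \<phi>: "\<phi> \<in> test_functions (UNIV - {0})" and \<xi>: "\<xi> \<in> test_functions (UNIV - {0})"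
  shows "(\<integral>x. inner (inverse_square_action a \<phi> x) (\<xi> x) \<partial>lborel) =
    (\<integral>x. inner (\<phi> x) (inverse_square_action a \<xi> x) \<partial>lborel)"
proof -
  obtain K where K: "compact K" "\<And>x. x \<notin> K \<Longrightarrow> \<phi> x = 0"
    using test_function_support_away_0[OF \<phi>] by metis
  obtain L where L: "compact L" "\<And>x. x \<notin> L \<Longrightarrow> \<xi> x = 0"
    using test_function_support_away_0[OF \<xi>] by metis
  \<comment> \<open>\<open>D b\<close> is the derivative in direction \<open>b\<close> of the
    component \<open>F\<close> below; the products of first derivatives cancel in it.\<close>
  define D where "D b x = inner (partial_deriv b (partial_deriv b \<phi>) x) (\<xi> x)
    - inner (\<phi> x) (partial_deriv b (partial_deriv b \<xi>) x)" for b x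
  have D: "integrable lborel (D b)" "(\<integral>x. D b x \<partial>lborel) = 0" if b: "b \<in> Basis" for b
  proof -
    note tf = \<phi> \<xi> test_functions_partial_deriv[OF \<phi> b] test_functions_partial_deriv[OF \<xi> b]
    note tf2 = tf test_functions_partial_deriv[OF tf(3) b] test_functions_partial_deriv[OF tf(4) b]
    define F where "F x = inner (partial_deriv b \<phi> x) (\<xi> x) - inner (\<phi> x) (partial_deriv b \<xi> x)" for x
    have F: "continuous_on UNIV F" "continuous_on UNIV (D b)"
      unfolding F_def D_def by (intro continuous_intros tf2[THEN test_function_continuous])+
    have KL: "compact (K \<inter> L)" using K L by (simp add: compact_Int_closed compact_imp_closed)
    \<comment> \<open>Every term has a factor from \<open>\<phi>\<close> and one from
      \<open>\<xi>\<close>, so it vanishes as soon as \<open>x\<close> leaves one of the two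
      supports.\<close>
    have zero: "F x = 0" "D b x = 0" if "x \<notin> K \<inter> L" for x
      using that K(2)[of x] L(2)[of x]
        partial_deriv_vanishing[OF compact_imp_closed[OF K(1)] K(2), where x = x and b = b]
        partial_deriv_vanishing[OF compact_imp_closed[OF L(1)] L(2), where x = x and b = b]
        partial_deriv_vanishing[OF compact_imp_closed[OF K(1)]
          partial_deriv_vanishing[OF compact_imp_closed[OF K(1)] K(2), where b = b], where x = x and b = b]
        partial_deriv_vanishing[OF compact_imp_closed[OF L(1)]
          partial_deriv_vanishing[OF compact_imp_closed[OF L(1)] L(2), where b = b], where x = x and b = b]
      by (auto simp: F_def D_def)
    have deriv: "((\<lambda>t. F (x + t *\<^sub>R b)) has_vector_derivative D b x) (at 0)" for x
      unfolding F_def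
      by (rule has_vector_derivative_eq_rhs, rule has_vector_derivative_diff[OF
            has_vector_derivative_inner[OF tf(3,2)[THEN has_vector_derivative_partial_deriv_test]]
            has_vector_derivative_inner[OF tf(1,4)[THEN has_vector_derivative_partial_deriv_test]]])
         (simp add: D_def)
    show "integrable lborel (D b)" "(\<integral>x. D b x \<partial>lborel) = 0"
      by (rule integral_directional_derivative[OF F KL zero deriv]; assumption)+
  qed
  \<comment> \<open>The potential is real and drops out of the difference, which leaves only the
    Laplacian terms.\<close>
  have "inner (inverse_square_action a \<phi> x) (\<xi> x) - inner (\<phi> x) (inverse_square_action a \<xi> x) =
      - (\<Sum>b\<in>Basis. D b x)" for x
    by (simp add: inverse_square_action_scaleR laplacian_def D_def inner_add_left inner_add_right
        inner_diff_left inner_diff_right inner_sum_left inner_sum_right sum_subtractf)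
  then have "(\<integral>x. inner (inverse_square_action a \<phi> x) (\<xi> x) - inner (\<phi> x) (inverse_square_action a \<xi> x) \<partial>lborel) = 0"
    using D by (simp add: Bochner_Integration.integral_sum)
  then show ?thesis
    using \<phi> \<xi> by (subst (asm) Bochner_Integration.integral_diff)
      (auto intro!: integrable_inner_square_integrable square_integrable_test_function square_integrable_inverse_square_action)
qed

text \<open>Hardy's inequality, by completing the square: with \<open>c = (N - 2) / 2\<close> the integrand on the right
  minus \<open>(a + c\<^sup>2) |\<phi>|\<^sup>2 / |x|\<^sup>2\<close> equals \<open>|\<nabla>\<phi> + c x \<phi> / |x|\<^sup>2|\<^sup>2\<close> minus the divergence of
  \<open>inner (\<nabla>\<phi>) \<phi> + c x |\<phi>|\<^sup>2 / |x|\<^sup>2\<close>.\<close>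

lemma inverse_square_action_hardy:
  fixes \<phi> :: "'a::euclidean_space \<Rightarrow> complex"
  assumes \<phi>: "\<phi> \<in> test_functions (UNIV - {0})"
  shows "(a + ((real DIM('a) - 2) / 2)\<^sup>2) * (\<integral>x. inner (\<phi> x) (\<phi> x) / inner x x \<partial>lborel)
    \<le> (\<integral>x. inner (inverse_square_action a \<phi> x) (\<phi> x) \<partial>lborel)"
proof -
  define c where "c = (real DIM('a) - 2) / 2"
  obtain K where K: "compact K" "0 \<notin> K" "\<And>x. x \<notin> K \<Longrightarrow> \<phi> x = 0"
      "\<And>x b. x \<notin> K \<Longrightarrow> partial_deriv b \<phi> x = 0" "\<And>x. x \<notin> K \<Longrightarrow> laplacian \<phi> x = 0"
    using test_function_support_away_0[OF \<phi>] by metis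
  \<comment> \<open>\<open>G b\<close> is the component in direction \<open>b\<close> of the field
    \<open>x |\<phi>|\<^sup>2 / |x|\<^sup>2\<close>, and \<open>G' b\<close> is its derivative in
    that direction. At the origin division by zero gives 0, which is consistent since
    \<open>\<phi>\<close> vanishes nearby.\<close>
  define G where "G b x = inner x b / inner x x * inner (\<phi> x) (\<phi> x)" for b x
  define G' where "G' b x = (1 / inner x x - 2 * (inner x b)\<^sup>2 / (inner x x)\<^sup>2) * inner (\<phi> x) (\<phi> x)
    + inner x b / inner x x * (2 * inner (partial_deriv b \<phi> x) (\<phi> x))" for b x
  define F where "F b x = inner (partial_deriv b \<phi> x) (\<phi> x) + c * G b x" for b x
  define D where "D b x = inner (partial_deriv b (partial_deriv b \<phi>) x) (\<phi> x)
    + inner (partial_deriv b \<phi> x) (partial_deriv b \<phi> x) + c * G' b x" for b x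
  have cont_inv: "continuous_on UNIV (\<lambda>x. h x * f x)"
    if "continuous_on (- {0}) h" "continuous_on UNIV f" "\<And>x. \<phi> x = 0 \<Longrightarrow> f x = 0"
    for h f :: "'a \<Rightarrow> real"
    by (rule continuous_on_mult_test_function[OF \<phi> that])
  have G_deriv: "((\<lambda>t. G b (x + t *\<^sub>R b)) has_vector_derivative G' b x) (at 0)"
    if b: "b \<in> Basis" for b x
  proof (cases "x = 0")
    case True
    \<comment> \<open>The quotient cannot be differentiated at the origin, but for small
      \<open>t\<close> the line stays in the complement of \<open>K\<close>, where
      \<open>G b\<close> is 0.\<close>
    have "((\<lambda>t. G b (x + t *\<^sub>R b)) has_vector_derivative 0) (at 0)"
    proof (rule has_vector_derivative_transform_within_open[of "\<lambda>_. 0"])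
      have "open (- K)" using compact_imp_closed[OF K(1)] by auto
      then show "open ((\<lambda>t. x + t *\<^sub>R b) -` (- K))"
        by (rule open_vimage) (intro continuous_intros)
    qed (use K True in \<open>auto simp: G_def\<close>)
    moreover have "G' b x = 0" using K True by (simp add: G'_def)
    ultimately show ?thesis by simp
  next
    case False
    have bb: "inner b b = 1" using b by simp
    have "((\<lambda>t. inner (x + t *\<^sub>R b) b / inner (x + t *\<^sub>R b) (x + t *\<^sub>R b)) has_real_derivative
        1 / inner x x - 2 * (inner x b)\<^sup>2 / (inner x x)\<^sup>2) (at 0)"
      using False bb
      by (auto intro!: derivative_eq_intros simp: inner_add_left inner_add_right inner_commute
          power2_eq_square field_simps)
    then have q: "((\<lambda>t. inner (x + t *\<^sub>R b) b / inner (x + t *\<^sub>R b) (x + t *\<^sub>R b)) has_vector_derivative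
        1 / inner x x - 2 * (inner x b)\<^sup>2 / (inner x x)\<^sup>2) (at 0)"
      by (simp add: has_real_derivative_iff_has_vector_derivative)
    show ?thesis
      unfolding G_def
      by (rule has_vector_derivative_eq_rhs, rule has_vector_derivative_mult[OF q
            has_vector_derivative_inner[OF \<phi>[THEN has_vector_derivative_partial_deriv_test] \<phi>[THEN has_vector_derivative_partial_deriv_test]]])
         (simp add: G'_def inner_commute algebra_simps)
  qed
  have D: "integrable lborel (D b)" "(\<integral>x. D b x \<partial>lborel) = 0" if b: "b \<in> Basis" for b
  proof -
    note tf = \<phi> test_functions_partial_deriv[OF \<phi> b]
    note tf2 = tf test_functions_partial_deriv[OF tf(2) b]
    have G: "continuous_on UNIV (G b)"
      unfolding G_def
      by (rule cont_inv) (auto intro!: continuous_intros test_function_continuous[OF \<phi>])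
    have G': "continuous_on UNIV (G' b)"
      unfolding G'_def
      by (intro continuous_on_add; rule continuous_on_mult_vanishing[of 0 _ _ K])
         (use K compact_imp_closed in \<open>auto intro!: continuous_intros tf2[THEN test_function_continuous]\<close>)
    have F: "continuous_on UNIV (F b)" "continuous_on UNIV (D b)"
      unfolding F_def D_def by (intro continuous_intros G G' tf2[THEN test_function_continuous])+
    have zero: "F b x = 0" "D b x = 0" if "x \<notin> K" for x
      using that K(3,4) by (auto simp: F_def D_def G_def G'_def)
    have deriv: "((\<lambda>t. F b (x + t *\<^sub>R b)) has_vector_derivative D b x) (at 0)" for x
      unfolding F_def
      by (rule has_vector_derivative_eq_rhs, rule has_vector_derivative_add[OF
            has_vector_derivative_inner[OF tf(2,1)[THEN has_vector_derivative_partial_deriv_test]]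
            has_vector_derivative_mult_right[OF G_deriv[OF b]]])
         (simp add: D_def)
    show "integrable lborel (D b)" "(\<integral>x. D b x \<partial>lborel) = 0"
      by (rule integral_directional_derivative[OF F K(1) zero deriv]; assumption)+
  qed
  have Lint: "integrable lborel (\<lambda>x. inner (inverse_square_action a \<phi> x) (\<phi> x))"
    using \<phi> by (intro integrable_inner_square_integrable square_integrable_test_function square_integrable_inverse_square_action)
  have Pint: "integrable lborel (\<lambda>x. inner (\<phi> x) (\<phi> x) / inner x x)"
  proof (rule integrable_compact_support[OF _ K(1)])
    have "continuous_on UNIV (\<lambda>x. 1 / inner x x * inner (\<phi> x) (\<phi> x))"
      by (rule cont_inv) (auto intro!: continuous_intros test_function_continuous[OF \<phi>])
    then show "continuous_on UNIV (\<lambda>x. inner (\<phi> x) (\<phi> x) / inner x x)" by simp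
  qed (use K in auto)
  \<comment> \<open>The sum of the \<open>D b\<close> is the divergence; it integrates to 0, so only
    the nonnegative squares remain under the integral.\<close>
  have square: "inner (inverse_square_action a \<phi> x) (\<phi> x) - (a + c\<^sup>2) * (inner (\<phi> x) (\<phi> x) / inner x x)
      + (\<Sum>b\<in>Basis. D b x) =
      (\<Sum>b\<in>Basis. (norm (partial_deriv b \<phi> x + (c * inner x b / inner x x) *\<^sub>R \<phi> x))\<^sup>2)" for x
  proof (cases "x = 0")
    case True
    then show ?thesis
      using K by (simp add: D_def G'_def inverse_square_action_def power2_norm_eq_inner)
  next
    case False
    define r where "r = inner x x"
    have r: "r \<noteq> 0" using False by (simp add: r_def)
    define p where "p = inner (\<phi> x) (\<phi> x)"
    define m where "m = (\<Sum>b\<in>Basis. inner x b * inner (partial_deriv b \<phi> x) (\<phi> x))"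
    define s where "s = (\<Sum>b\<in>Basis. inner (partial_deriv b \<phi> x) (partial_deriv b \<phi> x))"
    have xb: "(\<Sum>b\<in>Basis. (inner x b)\<^sup>2) = r"
      unfolding r_def by (subst euclidean_inner) (simp add: power2_eq_square)
    have 1: "inner (inverse_square_action a \<phi> x) (\<phi> x) = - inner (laplacian \<phi> x) (\<phi> x) + a / r * p"
      by (simp add: inverse_square_action_scaleR inner_diff_left inner_add_left r_def p_def
          power2_norm_eq_inner)
    have "(\<Sum>b\<in>Basis. G' b x) = (\<Sum>b\<in>Basis. p / r - 2 * p / r\<^sup>2 * (inner x b)\<^sup>2
        + 2 / r * (inner x b * inner (partial_deriv b \<phi> x) (\<phi> x)))"
      using r by (intro sum.cong) (auto simp: G'_def r_def[symmetric] p_def[symmetric] field_simps)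
    also have "\<dots> = real DIM('a) * (p / r) - 2 * p / r\<^sup>2 * r + 2 / r * m"
      by (simp only: sum.distrib sum_subtractf sum_distrib_left[symmetric] xb m_def[symmetric] sum_constant)
    finally have 2: "(\<Sum>b\<in>Basis. D b x) = inner (laplacian \<phi> x) (\<phi> x) + s
        + c * (real DIM('a) * (p / r) - 2 * p / r\<^sup>2 * r + 2 / r * m)"
      by (simp add: D_def sum.distrib laplacian_def inner_sum_left s_def flip: sum_distrib_left)
    have "(\<Sum>b\<in>Basis. (norm (partial_deriv b \<phi> x + (c * inner x b / inner x x) *\<^sub>R \<phi> x))\<^sup>2)
      = (\<Sum>b\<in>Basis. inner (partial_deriv b \<phi> x) (partial_deriv b \<phi> x)
        + 2 * c / r * (inner x b * inner (partial_deriv b \<phi> x) (\<phi> x)) + c\<^sup>2 * p / r\<^sup>2 * (inner x b)\<^sup>2)"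
      unfolding power2_norm_eq_inner
      by (intro sum.cong) (auto simp: inner_add_left inner_add_right inner_commute
          r_def[symmetric] p_def[symmetric] power2_eq_square mult_ac)
    also have "\<dots> = s + 2 * c / r * m + c\<^sup>2 * p / r\<^sup>2 * r"
      by (simp only: sum.distrib sum_distrib_left[symmetric] xb m_def[symmetric] s_def[symmetric])
    finally have 3: "(\<Sum>b\<in>Basis. (norm (partial_deriv b \<phi> x + (c * inner x b / inner x x) *\<^sub>R \<phi> x))\<^sup>2)
      = s + 2 * c / r * m + c\<^sup>2 * p / r\<^sup>2 * r" .
    \<comment> \<open>The coefficient of \<open>p / r\<close> on the left is
      \<open>c * (N - 2) - c\<^sup>2\<close>, with \<open>N\<close> the dimension. It must equal
      \<open>c\<^sup>2\<close>, and this value of \<open>c\<close> achieves that; it is also the one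
      that maximises the coefficient.\<close>
    have N: "real DIM('a) = 2 * c + 2" by (simp add: c_def field_simps)
    show ?thesis
      unfolding 1 2 3 N using r
      by (simp add: p_def[symmetric] r_def[symmetric] field_simps power2_eq_square)
  qed
  have "0 \<le> (\<integral>x. inner (inverse_square_action a \<phi> x) (\<phi> x) - (a + c\<^sup>2) * (inner (\<phi> x) (\<phi> x) / inner x x)
      + (\<Sum>b\<in>Basis. D b x) \<partial>lborel)"
    unfolding square by (intro Bochner_Integration.integral_nonneg sum_nonneg) auto
  also have "\<dots> = (\<integral>x. inner (inverse_square_action a \<phi> x) (\<phi> x) \<partial>lborel)
      - (a + c\<^sup>2) * (\<integral>x. inner (\<phi> x) (\<phi> x) / inner x x \<partial>lborel)"
    using Lint Pint D by (simp add: Bochner_Integration.integral_sum del: times_divide_eq_right)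
  finally show ?thesis by (simp add: c_def)
qed

text \<open>Cauchy-Schwarz in \<open>l2\<close> for \<open>|x| g\<close> and
  \<open>\<phi> / |x|\<close>, whose pointwise inner product is that of \<open>g\<close> and
  \<open>\<phi>\<close>.\<close>

lemma test_function_weighted_bound:
  fixes g \<phi> :: "'a::euclidean_space \<Rightarrow> complex"
  assumes g: "g \<in> test_functions (UNIV - {0})" and \<phi>: "\<phi> \<in> test_functions (UNIV - {0})"
  shows "(\<integral>x. inner (g x) (\<phi> x) \<partial>lborel)\<^sup>2 \<le>
    (\<integral>x. inner x x * inner (g x) (g x) \<partial>lborel) * (\<integral>x. inner (\<phi> x) (\<phi> x) / inner x x \<partial>lborel)"
proof -
  define u where "u x = of_real (norm x) * g x" for x
  define v where "v x = of_real (1 / norm x) * \<phi> x" for x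
  obtain K where K: "compact K" "\<And>x. x \<notin> K \<Longrightarrow> g x = 0"
    using test_function_support_away_0[OF g] by metis
  obtain L where L: "compact L" "0 \<notin> L" "\<And>x. x \<notin> L \<Longrightarrow> \<phi> x = 0"
    using test_function_support_away_0[OF \<phi>] by metis
  have u: "square_integrable u"
    by (rule square_integrable_compact_support[OF _ K(1)])
       (use K(2) in \<open>auto simp: u_def intro!: continuous_intros test_function_continuous[OF g]\<close>)
  have "continuous_on UNIV v"
    unfolding v_def
    by (rule continuous_on_mult_test_function[OF \<phi>]) (auto intro!: continuous_intros test_function_continuous[OF \<phi>])
  then have v: "square_integrable v"
    by (rule square_integrable_compact_support[OF _ L(1)]) (simp add: v_def L)
  \<comment> \<open>At the origin \<open>v\<close> is 0 by the convention for division, so the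
    pointwise identity there rests on \<open>\<phi> 0 = 0\<close>.\<close>
  have "\<phi> 0 = 0" using L by blast
  then have uv: "inner (u x) (v x) = inner (g x) (\<phi> x)" for x
    unfolding u_def v_def scaleR_conv_of_real[symmetric] by (cases "x = 0") simp_all
  have uu: "inner (u x) (u x) = inner x x * inner (g x) (g x)" for x
    unfolding u_def scaleR_conv_of_real[symmetric] by (simp add: power2_eq_square flip: power2_norm_eq_inner)
  have vv: "inner (v x) (v x) = inner (\<phi> x) (\<phi> x) / inner x x" for x
    unfolding v_def scaleR_conv_of_real[symmetric] by (simp add: power2_eq_square flip: power2_norm_eq_inner)
  show ?thesis
    using Cauchy_Schwarz_ineq[of "abs_l2 u" "abs_l2 v"] u v
    by (simp add: inner_abs_l2 uv uu vv)
qed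

section \<open>Uniform boundedness for the inverse-square wave equation\<close>

theorem corollary1p6:
  fixes a :: real and g :: "real ^ 'n \<Rightarrow> complex" and w :: "real \<Rightarrow> (real ^ 'n) l2"
  assumes "CARD('n) \<ge> 2"
    and "a > - (((real CARD('n) - 2) / 2)\<^sup>2)"
    and "g \<in> test_functions (UNIV - {0})"
    and "wave_solution (inverse_square_operator a) (abs_l2 g) w"
  shows "bdd_above ((\<lambda>t. norm (w t)) ` {0..})"
proof -
  define T where "T = (inverse_square_minimal a :: ((real ^ 'n) l2 \<times> (real ^ 'n) l2) set)"
  \<comment> \<open>\<open>\<delta>\<close> is the distance of \<open>a\<close> from the critical
    Hardy constant and \<open>A\<close> the squared norm of \<open>|x| g\<close>; their quotient
    \<open>A / \<delta>\<close> serves as the constant \<open>C\<close> of the abstract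
    bound.\<close>
  define \<delta> where "\<delta> = a + ((real CARD('n) - 2) / 2)\<^sup>2"
  define A where "A = (\<integral>x. inner x x * inner (g x) (g x) \<partial>lborel)"
  have \<delta>: "\<delta> > 0" using assms(2) by (simp add: \<delta>_def)
  have A: "A \<ge> 0" unfolding A_def by (intro Bochner_Integration.integral_nonneg) auto
  have T: "subspace T" unfolding T_def by (rule subspace_inverse_square_minimal)
  have TE: "\<exists>\<phi>. \<phi> \<in> test_functions (UNIV - {0}) \<and> x = abs_l2 \<phi> \<and> f = abs_l2 (inverse_square_action a \<phi>)"
    if "(x, f) \<in> T" for x f
    using that by (auto simp: T_def inverse_square_minimal_eq)
  have sym: "inner f y = inner x h" if xf: "(x, f) \<in> T" and yh: "(y, h) \<in> T" for x f y h
  proof -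
    obtain \<phi> where \<phi>: "\<phi> \<in> test_functions (UNIV - {0})"
      "x = abs_l2 \<phi>" "f = abs_l2 (inverse_square_action a \<phi>)" using TE[OF xf] by blast
    obtain \<xi> where \<xi>: "\<xi> \<in> test_functions (UNIV - {0})"
      "y = abs_l2 \<xi>" "h = abs_l2 (inverse_square_action a \<xi>)" using TE[OF yh] by blast
    show ?thesis
      using \<phi> \<xi> inverse_square_action_symmetric[OF \<phi>(1) \<xi>(1)]
      by (simp add: inner_abs_l2 square_integrable_test_function square_integrable_inverse_square_action)
  qed
  have form: "0 \<le> inner f x \<and> (inner (abs_l2 g) x)\<^sup>2 \<le> A / \<delta> * inner f x" if xf: "(x, f) \<in> T" for x f
  proof -
    obtain \<phi> where \<phi>: "\<phi> \<in> test_functions (UNIV - {0})"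
      "x = abs_l2 \<phi>" "f = abs_l2 (inverse_square_action a \<phi>)" using TE[OF xf] by blast
    define P where "P = (\<integral>x. inner (\<phi> x) (\<phi> x) / inner x x \<partial>lborel)"
    have P: "P \<ge> 0" unfolding P_def by (intro Bochner_Integration.integral_nonneg) auto
    have hardy: "\<delta> * P \<le> inner f x"
      using inverse_square_action_hardy[OF \<phi>(1), of a] \<phi>
      by (simp add: inner_abs_l2 square_integrable_test_function square_integrable_inverse_square_action
          \<delta>_def P_def)
    have "(inner (abs_l2 g) x)\<^sup>2 \<le> A * P"
      using test_function_weighted_bound[OF assms(3) \<phi>(1)] \<phi> assms(3)
      by (simp add: inner_abs_l2 square_integrable_test_function A_def P_def)
    \<comment> \<open>Strict positivity of \<open>\<delta>\<close> enters here: Hardy's inequality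
      is divided by it to bound the weighted norm by the form.\<close>
    also have "\<dots> \<le> A * (inner f x / \<delta>)"
      using hardy \<delta> A by (intro mult_left_mono) (auto simp: field_simps)
    finally have "(inner (abs_l2 g) x)\<^sup>2 \<le> A / \<delta> * inner f x" by simp
    moreover have "0 \<le> \<delta> * P" using \<delta> P by simp
    ultimately show ?thesis using hardy by linarith
  qed
  then have pos: "0 \<le> inner f x" and bound: "(inner (abs_l2 g) x)\<^sup>2 \<le> A / \<delta> * inner f x"
    if "(x, f) \<in> T" for x f
    using that by blast+
  obtain w' w'' where w: "\<And>t. t \<ge> 0 \<Longrightarrow> (w has_vector_derivative w' t) (at t within {0..})"
    and w': "\<And>t. t \<ge> 0 \<Longrightarrow> (w' has_vector_derivative w'' t) (at t within {0..})"
    and w'': "continuous_on {0..} w''"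
    and eq: "\<And>t. t \<ge> 0 \<Longrightarrow> (w t, - w'' t) \<in> friedrichs_extension T"
    and init: "w 0 = 0" "w' 0 = abs_l2 g"
    using assms(4) by (auto simp: wave_solution_def inverse_square_operator_def T_def)
  have "norm (w t) \<le> sqrt (A / \<delta>)" if "t \<ge> 0" for t
  proof (rule real_le_rsqrt)
    show "(norm (w t))\<^sup>2 \<le> A / \<delta>"
    proof (rule symmetric_wave_bound[OF subspace_friedrichs_extension[OF T pos] _ _ _ w w' w'' eq init that])
      show "inner f v = inner u h" if "(u, f) \<in> friedrichs_extension T" "(v, h) \<in> friedrichs_extension T" for u f v h
        by (rule friedrichs_extension_symmetric[OF T sym pos that])
      show "(inner (abs_l2 g) u)\<^sup>2 \<le> A / \<delta> * inner f u" if "(u, f) \<in> friedrichs_extension T" for u f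
        by (rule friedrichs_extension_form_bound[OF T sym pos bound that])
      show "0 \<le> A / \<delta>" using A \<delta> by simp
    qed
  qed
  then show ?thesis by (intro bdd_aboveI2) auto
qed

end
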